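(* A unit (local) vector field $\xi$ on the unit sphere $S^{n+1}$ generates a totally geodesic submanifold $\xi(S^{n+1})\subset T_1S^{n+1}$ if and only if $\xi$ satisfies, for all vector fields $X,Y$ on its domain, $$(\nabla_XA_\xi)Y=\tfrac12\Big[(\mathcal L_\xi g)(X,Y)\,A_\xi\xi+\langle\xi,X\rangle\,(A_\xi^2Y+Y)+\langle\xi,Y\rangle\,(A_\xi^2X-X)\Big]+\langle A_\xi X,A_\xi Y\rangle\,\xi,$$ where $(\mathcal L_\xi g)(X,Y)=\langle\nabla_X\xi,Y\rangle+\langle X,\nabla_Y\xi\rangle$ is the Lie derivative of the metric tensor in the direction of $\xi$.
   Context: $g=\langle\cdot,\cdot\rangle$ is the standard round metric on the unit sphere and $\nabla$ its Levi-Civita connection. For a unit vector field $\xi$ put $A_\xi X=-\nabla_X\xi$ and $(\nabla_XA_\xi)Y=-(\nabla_X\nabla_Y\xi-\nabla_{\nabla_XY}\xi)$. Sasaki metric: at $Q=(q,\xi)\in TM$, each $X\in T_qM$ has a horizontal lift $X^h$ and a vertical lift $X^v$ in $T_QTM$ (with respect to $\nabla$); the Sasaki metric on $TM$ is determined by $\langle\langle X^h,Y^h\rangle\rangle=\langle X,Y\rangle$, $\langle\langle X^h,Y^v\rangle\rangle=0$, $\langle\langle X^v,Y^v\rangle\rangle=\langle X,Y\rangle$. The unit tangent bundle $T_1M$ carries the induced metric. A unit vector field $\xi$ (possibly only locally defined) is viewed as the imbedding $q\mapsto(q,\xi(q))$ into $T_1S^{n+1}$, and $\xi(S^{n+1})$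 denotes its image (for a local field, the image of its domain). *)

theory Defs
  imports "HOL-Analysis.Analysis"
begin

text \<open>
  Manifolds are embedded submanifolds \<open>M\<close> of a Euclidean space, given as sets of points.
  A vector field is an ambient-valued function of which only the values on its domain matter; a
  Riemannian metric is a function \<open>g\<close>, where \<open>g p\<close> is used only on pairs of vectors of the
  tangent space at \<open>p\<close>.
\<close>

text \<open>In finite dimension, continuity of all iterated directional derivatives is the usual
  \<open>C\<^sup>k\<close> condition. Only meaningful for open \<open>W\<close>.\<close>

primrec C_k_on ::
  "nat \<Rightarrow> ('a::euclidean_space \<Rightarrow> 'b::euclidean_space) \<Rightarrow> 'a set \<Rightarrow> bool" where
  "C_k_on 0 f W \<longleftrightarrow> continuous_on W f"
| "C_k_on (Suc k) f W \<longleftrightarrow>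
     (\<forall>x\<in>W. f differentiable (at x)) \<and> (\<forall>v. C_k_on k (\<lambda>x. frechet_derivative f (at x) v) W)"

text \<open>Smoothness on an arbitrary subset of Euclidean space: local smooth extendability to open
  sets of the ambient space.\<close>

definition smooth_on ::
  "'a::euclidean_space set \<Rightarrow> ('a \<Rightarrow> 'b::euclidean_space) \<Rightarrow> bool" where
  "smooth_on S f \<longleftrightarrow>
     (\<forall>x\<in>S. \<exists>W F. open W \<and> x \<in> W \<and> (\<forall>k. C_k_on k F W) \<and> (\<forall>y\<in>W \<inter> S. F y = f y))"

definition tangent_space :: "'a::euclidean_space set \<Rightarrow> 'a \<Rightarrow> 'a set" where
  "tangent_space M p =
     {v. \<exists>c e. 0 < e \<and> smooth_on {-e<..<e} c \<and> c ` {-e<..<e} \<subseteq> M \<and> c 0 = p \<and>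
               (c has_vector_derivative v) (at (0::real))}"

definition vector_field_on ::
  "'a::euclidean_space set \<Rightarrow> 'a set \<Rightarrow> ('a \<Rightarrow> 'a) \<Rightarrow> bool" where
  "vector_field_on M S X \<longleftrightarrow>
     openin (top_of_set M) S \<and> smooth_on S X \<and> (\<forall>p\<in>S. X p \<in> tangent_space M p)"

text \<open>A derivative within \<open>M\<close> is in general not unique as a linear map on the ambient space, but
  its values on tangent vectors of \<open>M\<close> are; it is only ever applied to tangent vectors.\<close>

definition deriv_along ::
  "'a::euclidean_space set \<Rightarrow> 'a \<Rightarrow> 'a \<Rightarrow> ('a \<Rightarrow> 'b::euclidean_space) \<Rightarrow> 'b" where
  "deriv_along M p v f = frechet_derivative f (at p within M) v"

definition lie_bracket ::
  "'a::euclidean_space set \<Rightarrow> ('a \<Rightarrow> 'a) \<Rightarrow> ('a \<Rightarrow> 'a) \<Rightarrow> 'a \<Rightarrow> 'a" where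
  "lie_bracket M X Y p = deriv_along M p (X p) Y - deriv_along M p (Y p) X"

text \<open>Connections act on vector fields defined on arbitrary open subsets of \<open>M\<close>;
  \<open>D X Y p\<close> is the value at \<open>p\<close> of the covariant derivative of \<open>Y\<close> along \<open>X\<close>.\<close>

definition affine_connection ::
  "'a::euclidean_space set \<Rightarrow> (('a \<Rightarrow> 'a) \<Rightarrow> ('a \<Rightarrow> 'a) \<Rightarrow> 'a \<Rightarrow> 'a) \<Rightarrow> bool" where
  "affine_connection M D \<longleftrightarrow>
     (\<forall>S X Y Z f. vector_field_on M S X \<longrightarrow> vector_field_on M S Y \<longrightarrow> vector_field_on M S Z \<longrightarrow>
        smooth_on S (f :: 'a \<Rightarrow> real) \<longrightarrow>
        vector_field_on M S (D X Y) \<and>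
        (\<forall>p\<in>S.
           D (\<lambda>q. X q + Y q) Z p = D X Z p + D Y Z p \<and>
           D (\<lambda>q. f q *\<^sub>R X q) Z p = f p *\<^sub>R D X Z p \<and>
           D X (\<lambda>q. Y q + Z q) p = D X Y p + D X Z p \<and>
           D X (\<lambda>q. f q *\<^sub>R Y q) p = f p *\<^sub>R D X Y p + deriv_along M p (X p) f *\<^sub>R Y p))"

definition levi_civita_connection ::
  "'a::euclidean_space set \<Rightarrow> ('a \<Rightarrow> 'a \<Rightarrow> 'a \<Rightarrow> real) \<Rightarrow>
   (('a \<Rightarrow> 'a) \<Rightarrow> ('a \<Rightarrow> 'a) \<Rightarrow> 'a \<Rightarrow> 'a) \<Rightarrow> bool" where
  "levi_civita_connection M g D \<longleftrightarrow>
     affine_connection M D \<and>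
     (\<forall>S X Y Z. vector_field_on M S X \<longrightarrow> vector_field_on M S Y \<longrightarrow> vector_field_on M S Z \<longrightarrow>
        (\<forall>p\<in>S.
           D X Y p - D Y X p = lie_bracket M X Y p \<and>
           deriv_along M p (X p) (\<lambda>q. g q (Y q) (Z q)) =
             g p (D X Y p) (Z p) + g p (Y p) (D X Z p)))"

text \<open>The normal component of \<open>D X Y\<close> along a submanifold \<open>N\<close> of \<open>M\<close>, where \<open>X\<close>, \<open>Y\<close> are local
  fields on \<open>M\<close> that are tangent to \<open>N\<close> along \<open>N\<close>.\<close>

definition second_fundamental_form ::
  "'a::euclidean_space set \<Rightarrow> ('a \<Rightarrow> 'a \<Rightarrow> 'a \<Rightarrow> real) \<Rightarrow>
   (('a \<Rightarrow> 'a) \<Rightarrow> ('a \<Rightarrow> 'a) \<Rightarrow> 'a \<Rightarrow> 'a) \<Rightarrow> 'a set \<Rightarrow> ('a \<Rightarrow> 'a) \<Rightarrow> ('a \<Rightarrow> 'a) \<Rightarrow> 'a \<Rightarrow> 'a" where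
  "second_fundamental_form M g D N X Y p =
     (THE w. w \<in> tangent_space M p \<and> (\<forall>z\<in>tangent_space N p. g p w z = 0) \<and>
             D X Y p - w \<in> tangent_space N p)"

definition totally_geodesic ::
  "'a::euclidean_space set \<Rightarrow> ('a \<Rightarrow> 'a \<Rightarrow> 'a \<Rightarrow> real) \<Rightarrow>
   (('a \<Rightarrow> 'a) \<Rightarrow> ('a \<Rightarrow> 'a) \<Rightarrow> 'a \<Rightarrow> 'a) \<Rightarrow> 'a set \<Rightarrow> bool" where
  "totally_geodesic M g D N \<longleftrightarrow>
     (\<forall>S X Y. vector_field_on M S X \<longrightarrow> vector_field_on M S Y \<longrightarrow>
        (\<forall>p\<in>S \<inter> N. X p \<in> tangent_space N p \<and> Y p \<in> tangent_space N p) \<longrightarrow>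
        (\<forall>p\<in>S \<inter> N. second_fundamental_form M g D N X Y p = 0))"

definition unit_tangent_bundle ::
  "'a::euclidean_space set \<Rightarrow> ('a \<Rightarrow> 'a \<Rightarrow> 'a \<Rightarrow> real) \<Rightarrow> ('a \<times> 'a) set" where
  "unit_tangent_bundle M g = {(q, u). q \<in> M \<and> u \<in> tangent_space M q \<and> g q u u = 1}"

text \<open>The horizontal lift of \<open>x\<close> at \<open>(q, u)\<close> is the image of \<open>x\<close> under the differential of any
  local section \<open>Y\<close> with \<open>Y q = u\<close> that is parallel at \<open>q\<close> in the direction \<open>x\<close>. The vertical
  lift is the velocity at \<open>0\<close> of \<open>t \<mapsto> (q, u + t x)\<close>.\<close>

definition horizontal_lift ::
  "'a::euclidean_space set \<Rightarrow> (('a \<Rightarrow> 'a) \<Rightarrow> ('a \<Rightarrow> 'a) \<Rightarrow> 'a \<Rightarrow> 'a) \<Rightarrow>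
   'a \<times> 'a \<Rightarrow> 'a \<Rightarrow> 'a \<times> 'a" where
  "horizontal_lift M nabla Q x =
     (THE w. \<exists>S X Y. vector_field_on M S X \<and> vector_field_on M S Y \<and> fst Q \<in> S \<and>
        X (fst Q) = x \<and> Y (fst Q) = snd Q \<and> nabla X Y (fst Q) = 0 \<and>
        w = deriv_along M (fst Q) x (\<lambda>y. (y, Y y)))"

definition vertical_lift :: "'a::euclidean_space \<Rightarrow> 'a \<times> 'a" where
  "vertical_lift x = (0, x)"

text \<open>Every tangent vector of the tangent bundle is uniquely the sum of a horizontal and a
  vertical lift.\<close>

definition sasaki_metric ::
  "'a::euclidean_space set \<Rightarrow> ('a \<Rightarrow> 'a \<Rightarrow> 'a \<Rightarrow> real) \<Rightarrow>
   (('a \<Rightarrow> 'a) \<Rightarrow> ('a \<Rightarrow> 'a) \<Rightarrow> 'a \<Rightarrow> 'a) \<Rightarrow> 'a \<times> 'a \<Rightarrow> 'a \<times> 'a \<Rightarrow> 'a \<times> 'a \<Rightarrow> real" where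
  "sasaki_metric M g nabla Q w w' =
     (THE r. \<exists>x\<in>tangent_space M (fst Q). \<exists>y\<in>tangent_space M (fst Q).
             \<exists>x'\<in>tangent_space M (fst Q). \<exists>y'\<in>tangent_space M (fst Q).
        w = horizontal_lift M nabla Q x + vertical_lift y \<and>
        w' = horizontal_lift M nabla Q x' + vertical_lift y' \<and>
        r = g (fst Q) x x' + g (fst Q) y y')"

abbreviation round_sphere :: "'a::euclidean_space set" where
  "round_sphere \<equiv> sphere 0 1"

abbreviation round_metric :: "'a::euclidean_space \<Rightarrow> 'a \<Rightarrow> 'a \<Rightarrow> real" where
  "round_metric \<equiv> \<lambda>p. inner"

definition shape_operator ::
  "(('a::euclidean_space \<Rightarrow> 'a) \<Rightarrow> ('a \<Rightarrow> 'a) \<Rightarrow> 'a \<Rightarrow> 'a) \<Rightarrow> ('a \<Rightarrow> 'a) \<Rightarrow> ('a \<Rightarrow> 'a) \<Rightarrow> 'a \<Rightarrow> 'a" where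
  "shape_operator nabla \<xi> X = (\<lambda>p. - nabla X \<xi> p)"

definition shape_operator_deriv ::
  "(('a::euclidean_space \<Rightarrow> 'a) \<Rightarrow> ('a \<Rightarrow> 'a) \<Rightarrow> 'a \<Rightarrow> 'a) \<Rightarrow>
   ('a \<Rightarrow> 'a) \<Rightarrow> ('a \<Rightarrow> 'a) \<Rightarrow> ('a \<Rightarrow> 'a) \<Rightarrow> 'a \<Rightarrow> 'a" where
  "shape_operator_deriv nabla \<xi> X Y = (\<lambda>p. - (nabla X (nabla Y \<xi>) p - nabla (nabla X Y) \<xi> p))"

definition lie_deriv_metric ::
  "(('a::euclidean_space \<Rightarrow> 'a) \<Rightarrow> ('a \<Rightarrow> 'a) \<Rightarrow> 'a \<Rightarrow> 'a) \<Rightarrow> ('a \<Rightarrow> 'a \<Rightarrow> 'a \<Rightarrow> real) \<Rightarrow>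
   ('a \<Rightarrow> 'a) \<Rightarrow> ('a \<Rightarrow> 'a) \<Rightarrow> ('a \<Rightarrow> 'a) \<Rightarrow> 'a \<Rightarrow> real" where
  "lie_deriv_metric nabla g \<xi> X Y = (\<lambda>p. g p (nabla X \<xi> p) (Y p) + g p (X p) (nabla Y \<xi> p))"

end

theory Submission
  imports Defs
begin

text \<open>
  On \<open>T\<^sub>1 S = {(q, u). \<bar>q\<bar> = \<bar>u\<bar> = 1, q \<bullet> u = 0}\<close> the Sasaki metric is the restriction of
  \<open>(x, y) \<bullet> (x', y') - (u \<bullet> x) (u \<bullet> x')\<close>. Its Levi-Civita connection is read off from the Koszul
  formula, in which only derivatives of this bilinear form appear besides the ambient derivative of
  the field. The tangent space of \<open>\<xi>(S)\<close> at \<open>(q, \<xi> q)\<close> is the graph of \<open>d\<xi>\<close>, and the second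
  fundamental form vanishes iff the covariant derivative of fields tangent to \<open>\<xi>(S)\<close> stays in this
  graph. Modulo \<open>\<xi>\<close> this is the stated equation; the \<open>\<xi>\<close>-component of the latter
  holds automatically, by differentiating \<open>\<nabla>\<^sub>Y \<xi> \<bullet> \<xi> = 0\<close>. Both conditions
  depend only on the values of the fields at \<open>q\<close>, so that it suffices to compare them
  for fields constructed by projecting constant vectors.
\<close>

text \<open>\<open>nabla\<close> and \<open>nablaT\<close> are known only through the Levi-Civita
  axioms, so their values have to be pinned down pointwise. In both cases the difference between
  connection and guessed formula is tangent, hence extends to a tangent field; the Koszul formula
  tested against that field shows that the difference has length zero. The guess on
  \<open>T1\<close> is the classical connection of a Sasaki metric, its factors 1/2 belonging to
  curvature terms of the unit sphere. Ambient derivatives of a map on the sphere are determined only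
  on tangent vectors. Near each point \<open>\<xi>\<close> is therefore extended to a smooth
  \<open>\<Xi>\<close>, whose first two derivatives turn both conditions into vector algebra. The
  pivot is \<open>geodesic_eq\<close>. For fields tangent to the graph, the derivative of the second
  field enters the horizontal part of the covariant derivative as some \<open>w\<close> and the
  vertical part as \<open>K q w\<close>, so it cancels. The unequal signs of \<open>Y\<close> and
  \<open>X\<close> in the theorem stem from the non-symmetric term
  \<open>(\<xi> q \<bullet> Y q) *\<^sub>R X q\<close> in the second covariant derivative of
  \<open>\<xi>\<close>: moved across, it turns -1/2 into +1/2.\<close>

section \<open>Smooth maps\<close>

lemma C_k_on_cong:
  assumes "open W" "\<And>x. x \<in> W \<Longrightarrow> f x = g x"
  shows "C_k_on k f W \<longleftrightarrow> C_k_on k g W"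
  using assms(2)
proof (induction k arbitrary: f g)
  case 0
  then show ?case by (simp cong: continuous_on_cong)
next
  case (Suc k)
  have D: "(f has_derivative D) (at x) \<longleftrightarrow> (g has_derivative D) (at x)" if "x \<in> W" for x D
    using has_derivative_transform_within_open[OF _ assms(1) that, of f D UNIV g]
      has_derivative_transform_within_open[OF _ assms(1) that, of g D UNIV f] Suc.prems
    by auto
  then have "f differentiable (at x) \<longleftrightarrow> g differentiable (at x)"
    and "frechet_derivative f (at x) = frechet_derivative g (at x)" if "x \<in> W" for x
    using that by (auto simp: differentiable_def frechet_derivative_def)
  then show ?case
    using Suc.IH[of "\<lambda>x. frechet_derivative f (at x) v" "\<lambda>x. frechet_derivative g (at x) v" for v]
    by auto
qed

text \<open>Lets the derivative be given by an explicit formula; uniqueness of the derivative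
  identifies it with the chosen \<open>frechet_derivative\<close>.\<close>

lemma C_k_on_SucI:
  assumes "open W" "\<And>x. x \<in> W \<Longrightarrow> (f has_derivative f' x) (at x)"
    "\<And>v. C_k_on k (\<lambda>x. f' x v) W"
  shows "C_k_on (Suc k) f W"
proof -
  have "frechet_derivative f (at x) = f' x" if "x \<in> W" for x
    using frechet_derivative_at[OF assms(2)[OF that]] by simp
  then have "C_k_on k (\<lambda>x. frechet_derivative f (at x) v) W" for v
    using C_k_on_cong[OF assms(1), of "\<lambda>x. frechet_derivative f (at x) v" "\<lambda>x. f' x v"] assms(3)
    by simp
  then show ?thesis using assms(2) by (auto simp: differentiable_def)
qed

lemma C_k_on_has_derivative:
  "C_k_on (Suc k) f W \<Longrightarrow> x \<in> W \<Longrightarrow> (f has_derivative frechet_derivative f (at x)) (at x)"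
  by (simp add: frechet_derivative_works)

lemma C_k_on_SucD: "C_k_on (Suc k) f W \<Longrightarrow> C_k_on k f W"
proof (induction k arbitrary: f)
  case 0
  then show ?case
    by (auto intro!: continuous_at_imp_continuous_on differentiable_imp_continuous_within)
qed auto

lemma C_k_on_subset: "C_k_on k f W \<Longrightarrow> V \<subseteq> W \<Longrightarrow> C_k_on k f V"
  by (induction k arbitrary: f) (auto intro: continuous_on_subset)

lemma C_k_on_const: "open W \<Longrightarrow> C_k_on k (\<lambda>x. c) W"
proof (induction k arbitrary: c)
  case (Suc k)
  then show ?case by (intro C_k_on_SucI[where f' = "\<lambda>x v. 0"]) auto
qed auto

lemma C_k_on_linear:
  assumes "open W" "bounded_linear f"
  shows "C_k_on k f W"
proof (cases k)
  case 0
  then show ?thesis using assms by (simp add: linear_continuous_on)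
next
  case (Suc k)
  show ?thesis unfolding Suc
    using assms by (intro C_k_on_SucI[where f' = "\<lambda>x. f"] C_k_on_const)
      (auto intro: bounded_linear_imp_has_derivative)
qed

lemma C_k_on_linear_image:
  assumes "open W" "bounded_linear h"
  shows "C_k_on k f W \<Longrightarrow> C_k_on k (\<lambda>x. h (f x)) W"
proof (induction k arbitrary: f)
  case 0
  then show ?case using assms(2) by (simp add: bounded_linear.continuous_on)
next
  case (Suc k)
  show ?case
    using Suc by (intro C_k_on_SucI[OF assms(1),
          where f' = "\<lambda>x v. h (frechet_derivative f (at x) v)"]
        bounded_linear.has_derivative[OF assms(2)]) (auto simp: frechet_derivative_works)
qed

lemma C_k_on_add:
  assumes "open W"
  shows "C_k_on k f W \<Longrightarrow> C_k_on k g W \<Longrightarrow> C_k_on k (\<lambda>x. f x + g x) W"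
proof (induction k arbitrary: f g)
  case 0
  then show ?case by (simp add: continuous_on_add)
next
  case (Suc k)
  show ?case
    using Suc by (intro C_k_on_SucI[OF assms, where f' =
          "\<lambda>x v. frechet_derivative f (at x) v + frechet_derivative g (at x) v"]
        has_derivative_add) (auto simp: frechet_derivative_works)
qed

lemma C_k_on_bilinear:
  assumes "open W" "bounded_bilinear h"
  shows "C_k_on k f W \<Longrightarrow> C_k_on k g W \<Longrightarrow> C_k_on k (\<lambda>x. h (f x) (g x)) W"
proof (induction k arbitrary: f g)
  case 0
  then show ?case using assms(2) by (simp add: bounded_bilinear.continuous_on)
next
  case (Suc k)
  have "C_k_on k f W" "C_k_on k g W" using Suc.prems C_k_on_SucD by blast+
  then show ?case
    using Suc by (intro C_k_on_SucI[OF assms(1), where f' =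
          "\<lambda>x v. h (f x) (frechet_derivative g (at x) v) + h (frechet_derivative f (at x) v) (g x)"]
        bounded_bilinear.FDERIV[OF assms(2)] C_k_on_add assms(1))
      (auto simp: frechet_derivative_works)
qed

lemma C_k_on_uminus: "open W \<Longrightarrow> C_k_on k f W \<Longrightarrow> C_k_on k (\<lambda>x. - f x) W"
  by (rule C_k_on_linear_image) (auto intro: bounded_linear_minus bounded_linear_ident)

lemma C_k_on_diff:
  "open W \<Longrightarrow> C_k_on k f W \<Longrightarrow> C_k_on k g W \<Longrightarrow> C_k_on k (\<lambda>x. f x - g x) W"
  using C_k_on_add[of W k f "\<lambda>x. - g x"] C_k_on_uminus by fastforce

lemma C_k_on_Pair:
  assumes "open W" "C_k_on k f W" "C_k_on k g W"
  shows "C_k_on k (\<lambda>x. (f x, g x)) W"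
proof -
  have "C_k_on k (\<lambda>x. (f x, 0) + (0, g x)) W"
    using assms by (intro C_k_on_add C_k_on_linear_image[where h = "\<lambda>y. (y, 0)"]
        C_k_on_linear_image[where h = "\<lambda>y. (0, y)"])
      (auto intro: bounded_linear_Pair bounded_linear_ident bounded_linear_zero)
  then show ?thesis by simp
qed

lemma C_k_on_sum:
  assumes "open W"
  shows "(\<And>i. i \<in> I \<Longrightarrow> C_k_on k (f i) W) \<Longrightarrow> C_k_on k (\<lambda>x. \<Sum>i\<in>I. f i x) W"
  by (induction I rule: infinite_finite_induct)
    (auto intro: C_k_on_const C_k_on_add assms)

lemmas C_k_on_inner = C_k_on_bilinear[OF _ bounded_bilinear_inner]
  and C_k_on_scaleR = C_k_on_bilinear[OF _ bounded_bilinear_scaleR]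
  and C_k_on_mult = C_k_on_bilinear[OF _ bounded_bilinear_mult]

lemma linear_Basis_expansion:
  fixes f :: "'a::euclidean_space \<Rightarrow> 'b::real_vector"
  assumes "linear f"
  shows "f v = (\<Sum>i\<in>Basis. (v \<bullet> i) *\<^sub>R f i)"
  using arg_cong[OF euclidean_representation[of v], of f] assms
  by (simp add: linear_sum linear_cmul)

text \<open>The direction \<open>g x\<close> varies with \<open>x\<close>, whereas
  \<open>C_k_on\<close> controls fixed directions only; expanding \<open>g x\<close> in the basis
  reduces to those.\<close>

lemma C_k_on_frechet_derivative:
  assumes "open W" "C_k_on (Suc k) f W" "C_k_on k g W"
  shows "C_k_on k (\<lambda>x. frechet_derivative f (at x) (g x)) W"
proof -
  have "C_k_on k (\<lambda>x. \<Sum>i\<in>Basis. (g x \<bullet> i) *\<^sub>R frechet_derivative f (at x) i) W"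
    using assms by (intro C_k_on_sum C_k_on_scaleR C_k_on_inner C_k_on_const) auto
  moreover have "frechet_derivative f (at x) (g x) =
      (\<Sum>i\<in>Basis. (g x \<bullet> i) *\<^sub>R frechet_derivative f (at x) i)" if "x \<in> W" for x
    using C_k_on_has_derivative[OF assms(2) that]
    by (intro linear_Basis_expansion) (simp add: has_derivative_linear)
  ultimately show ?thesis
    using C_k_on_cong[OF assms(1)] by (metis (no_types, lifting))
qed

text \<open>The chain rule differentiates \<open>g\<close> in a direction that depends on
  \<open>x\<close>. Expanded over the basis, its factors
  \<open>frechet_derivative g (at (f x)) i\<close> are again compositions with the same
  \<open>f\<close>, so the induction hypothesis applies to them.\<close>

lemma C_k_on_compose:
  assumes "open W" "open V" "f ` W \<subseteq> V"
  shows "C_k_on k g V \<Longrightarrow> C_k_on k f W \<Longrightarrow> C_k_on k (\<lambda>x. g (f x)) W"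
proof (induction k arbitrary: g)
  case 0
  then show ?case using assms(3) by (auto intro: continuous_on_compose2)
next
  case (Suc k)
  let ?D = "\<lambda>x v. \<Sum>i\<in>Basis. (frechet_derivative f (at x) v \<bullet> i) *\<^sub>R frechet_derivative g (at (f x)) i"
  show ?case
  proof (rule C_k_on_SucI[OF assms(1)])
    show "((\<lambda>x. g (f x)) has_derivative ?D x) (at x)" if "x \<in> W" for x
    proof -
      have g: "(g has_derivative frechet_derivative g (at (f x))) (at (f x))"
        using Suc.prems(1) that assms(3) by (auto simp: frechet_derivative_works)
      have "((\<lambda>x. g (f x)) has_derivative
          (\<lambda>v. frechet_derivative g (at (f x)) (frechet_derivative f (at x) v))) (at x)"
        using diff_chain_at[OF C_k_on_has_derivative[OF Suc.prems(2) that] g]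
        by (simp add: o_def)
      moreover have "frechet_derivative g (at (f x)) (frechet_derivative f (at x) v) = ?D x v" for v
        using g by (intro linear_Basis_expansion) (simp add: has_derivative_linear)
      ultimately show ?thesis by simp
    qed
    have "C_k_on k f W" using Suc.prems(2) by (rule C_k_on_SucD)
    then show "C_k_on k (\<lambda>x. ?D x v) W" for v
      using Suc assms(1) by (intro C_k_on_sum C_k_on_scaleR C_k_on_inner C_k_on_const) auto
  qed
qed

text \<open>Wanted for the exponent -1/2 that normalises curves; the exponent is kept general
  because differentiation lowers it.\<close>

lemma C_k_on_powr: "C_k_on k (\<lambda>x::real. x powr a) {0<..}"
proof (induction k arbitrary: a)
  case 0
  then show ?case by (auto intro!: continuous_intros)
next
  case (Suc k)
  have "((\<lambda>x. x powr a) has_derivative (*) (a * x powr (a - 1))) (at x)"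
    if "x \<in> {0<..}" for x
    using that has_real_derivative_powr[of x a]
    by (simp add: has_field_derivative_def)
  then show ?case
    by (rule C_k_on_SucI[rotated]) (auto intro!: C_k_on_mult C_k_on_const Suc)
qed

lemma smooth_on_openI: "open W \<Longrightarrow> S \<subseteq> W \<Longrightarrow> (\<And>k. C_k_on k f W) \<Longrightarrow> smooth_on S f"
  unfolding smooth_on_def by blast

section \<open>Derivatives along tangent vectors\<close>

lemma has_derivative_transform_openin:
  assumes "(f has_derivative f') (at p within M)" "openin (top_of_set M) S" "p \<in> S"
    and "\<And>y. y \<in> S \<Longrightarrow> f y = g y"
  shows "(g has_derivative f') (at p within M)"
proof -
  obtain T where "open T" "S = M \<inter> T" using assms(2) by (auto simp: openin_open)
  then have "\<forall>\<^sub>F y in at p within M. f y = g y"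
    using assms(3,4) unfolding eventually_at_topological by blast
  then show ?thesis
    using has_derivative_transform_eventually[OF assms(1)] assms(3,4) \<open>S = M \<inter> T\<close> by blast
qed

lemma tangent_space_mono: "N \<subseteq> M \<Longrightarrow> tangent_space N p \<subseteq> tangent_space M p"
  unfolding tangent_space_def by blast

text \<open>Pulling \<open>f\<close> back along a curve in \<open>M\<close> with velocity
  \<open>v\<close> gives a function of one real variable on an open interval, where derivatives are
  unique.\<close>

lemma has_derivative_unique_on_tangent_space:
  assumes "(f has_derivative D) (at p within M)" "(f has_derivative D') (at p within M)"
    and "v \<in> tangent_space M p"
  shows "D v = D' v"
proof -
  obtain c e where c: "0 < e" "c ` {-e<..<e} \<subseteq> M" "c 0 = p"
    "(c has_vector_derivative v) (at (0::real))"
    using assms(3) by (auto simp: tangent_space_def)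
  have "((\<lambda>t. f (c t)) has_derivative (\<lambda>t. F (t *\<^sub>R v))) (at 0)"
    if "(f has_derivative F) (at p within M)" for F
  proof -
    have "(c has_derivative (\<lambda>t. t *\<^sub>R v)) (at 0 within {-e<..<e})"
      using c(4) unfolding has_vector_derivative_def by (rule has_derivative_at_withinI)
    moreover have "(f has_derivative F) (at (c 0) within c ` {-e<..<e})"
      unfolding c(3) using that c(2) by (rule has_derivative_subset)
    ultimately have "((\<lambda>t. f (c t)) has_derivative (\<lambda>t. F (t *\<^sub>R v))) (at 0 within {-e<..<e})"
      by (rule has_derivative_in_compose)
    then show ?thesis using c(1) by (simp add: at_within_open[of 0 "{-e<..<e}"])
  qed
  from has_derivative_unique[OF this[OF assms(1)] this[OF assms(2)]]
  have "D (1 *\<^sub>R v) = D' (1 *\<^sub>R v)" by (rule fun_cong)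
  then show ?thesis by simp
qed

lemma deriv_along_eq:
  assumes "(f has_derivative f') (at p within M)" "v \<in> tangent_space M p"
  shows "deriv_along M p v f = f' v"
proof -
  have "f differentiable (at p within M)" using assms(1) by (auto simp: differentiable_def)
  then have "(f has_derivative frechet_derivative f (at p within M)) (at p within M)"
    by (simp add: frechet_derivative_works)
  from has_derivative_unique_on_tangent_space[OF this assms] show ?thesis
    by (simp add: deriv_along_def)
qed

text \<open>The source of most linear relations below: a constraint valid along \<open>M\<close>,
  such as \<open>p \<bullet> p = 1\<close>, is differentiated in tangent directions.\<close>

lemma has_derivative_const_on_tangent_space:
  assumes "(f has_derivative f') (at p within M)" "openin (top_of_set M) S" "p \<in> S"
    and "\<And>y. y \<in> S \<Longrightarrow> f y = k" "v \<in> tangent_space M p"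
  shows "f' v = 0"
  using has_derivative_unique_on_tangent_space[OF
      has_derivative_transform_openin[OF assms(1-4)] has_derivative_const assms(5)] by simp

text \<open>Shrinking \<open>W\<close> by the ambient open set that cuts out \<open>S\<close> makes
  the extension agree with \<open>f\<close> on all of \<open>W \<inter> M\<close>, so that it can
  serve for derivatives within \<open>M\<close>.\<close>

lemma smooth_on_local_extension:
  assumes "smooth_on S f" "openin (top_of_set M) S" "p \<in> S"
  obtains W F where "open W" "p \<in> W" "\<forall>k. C_k_on k F W" "W \<inter> M \<subseteq> S"
    "\<forall>y\<in>W \<inter> M. F y = f y"
proof -
  obtain T where T: "open T" "S = M \<inter> T" using assms(2) by (auto simp: openin_open)
  obtain W F where W: "open W" "p \<in> W" "\<forall>k. C_k_on k F W" "\<forall>y\<in>W \<inter> S. F y = f y"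
    using bspec[OF assms(1)[unfolded smooth_on_def] assms(3)] by (elim exE conjE)
  show ?thesis
  proof (rule that[of "W \<inter> T" F])
    show "\<forall>k. C_k_on k F (W \<inter> T)" using W(3) C_k_on_subset[of _ F W "W \<inter> T"] by simp
  qed (use T W assms(3) in auto)
qed

lemma smooth_on_has_derivative:
  assumes "smooth_on S f" "openin (top_of_set M) S" "p \<in> S"
  obtains f' where "(f has_derivative f') (at p within M)"
proof -
  obtain W F where W: "open W" "p \<in> W" "\<forall>k. C_k_on k F W" "W \<inter> M \<subseteq> S"
    "\<forall>y\<in>W \<inter> M. F y = f y"
    by (rule smooth_on_local_extension[OF assms])
  have "p \<in> M" using assms by (auto simp: openin_open)
  have "(F has_derivative frechet_derivative F (at p)) (at p within M)"
    using C_k_on_has_derivative[OF spec[OF W(3)] W(2)] by (rule has_derivative_at_withinI)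
  moreover have "openin (top_of_set M) (M \<inter> W)" using W(1) by (simp add: openin_open_Int)
  ultimately have "(f has_derivative frechet_derivative F (at p)) (at p within M)"
    by (rule has_derivative_transform_openin) (use W(2,5) \<open>p \<in> M\<close> in auto)
  then show ?thesis by (rule that)
qed

section \<open>Tangent spaces of the sphere and of its unit tangent bundle\<close>

lemma round_sphere_iff: "q \<in> round_sphere \<longleftrightarrow> q \<bullet> q = 1"
  by (simp add: norm_eq_1)

lemma has_derivative_powr_at_1:
  assumes "(f has_real_derivative 0) (at (t::real))" "f t = 1"
  shows "((\<lambda>t. f t powr a) has_real_derivative 0) (at t)"
  using DERIV_powr[OF assms(1) _ DERIV_const] assms(2) by simp

text \<open>By orthogonality the squared length of \<open>q + t *\<^sub>R x\<close> is
  \<open>1 + t\<^sup>2 * (x \<bullet> x)\<close>, which is never zero and is stationary at 0.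
  Normalising therefore keeps the curve smooth on the whole line and does not change its velocity at
  0.\<close>

lemma normalized_line:
  fixes q x :: "'a::euclidean_space"
  assumes "q \<bullet> q = 1" "x \<bullet> q = 0"
  defines "c \<equiv> \<lambda>t::real. (1 + t\<^sup>2 * (x \<bullet> x)) powr (-1/2) *\<^sub>R (q + t *\<^sub>R x)"
  shows "C_k_on k c UNIV" "c t \<bullet> c t = 1" "c 0 = q" "(c has_vector_derivative x) (at 0)"
proof -
  have pos: "1 + t\<^sup>2 * (x \<bullet> x) > 0" for t
    by (simp add: add_pos_nonneg)
  have 1: "C_k_on k (\<lambda>t::real. t) UNIV" by (intro C_k_on_linear bounded_linear_ident) auto
  have "C_k_on k (\<lambda>t. 1 + t\<^sup>2 * (x \<bullet> x)) UNIV"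
    unfolding power2_eq_square using 1 by (intro C_k_on_add C_k_on_const C_k_on_mult) auto
  then have "C_k_on k (\<lambda>t. (1 + t\<^sup>2 * (x \<bullet> x)) powr (-1/2)) UNIV"
    using pos by (intro C_k_on_compose[OF _ _ _ C_k_on_powr]) auto
  then show "C_k_on k c UNIV"
    unfolding c_def using 1 by (intro C_k_on_scaleR C_k_on_add C_k_on_const) auto
  have "(q + t *\<^sub>R x) \<bullet> (q + t *\<^sub>R x) = 1 + t\<^sup>2 * (x \<bullet> x)"
    using assms(1,2) by (simp add: inner_simps inner_commute power2_eq_square)
  moreover have "(1 + t\<^sup>2 * (x \<bullet> x)) powr (-1/2) * (1 + t\<^sup>2 * (x \<bullet> x)) powr (-1/2)
      = inverse (1 + t\<^sup>2 * (x \<bullet> x))"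
    using pos[of t] powr_add[of "1 + t\<^sup>2 * (x \<bullet> x)" "-1/2" "-1/2"] by (simp add: powr_minus)
  ultimately show "c t \<bullet> c t = 1"
    using pos[of t] by (simp add: c_def mult.assoc[symmetric])
  show "c 0 = q" by (simp add: c_def)
  show "(c has_vector_derivative x) (at 0)"
  proof -
    have "((\<lambda>t. (1 + t\<^sup>2 * (x \<bullet> x)) powr (-1/2)) has_real_derivative 0) (at 0)"
      by (rule has_derivative_powr_at_1) (auto intro!: derivative_eq_intros)
    then show ?thesis
      unfolding c_def by (auto intro!: derivative_eq_intros)
  qed
qed

lemma tangent_space_round_sphere:
  fixes p :: "'a::euclidean_space"
  assumes "p \<in> round_sphere"
  shows "tangent_space round_sphere p = {v. v \<bullet> p = 0}"
proof (intro equalityI subsetI CollectI)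
  fix v assume v: "v \<in> tangent_space round_sphere p"
  have "((\<lambda>y. y \<bullet> y) has_derivative (\<lambda>h. 2 * (h \<bullet> p))) (at p within round_sphere)"
    by (auto intro!: derivative_eq_intros simp: inner_commute)
  from has_derivative_const_on_tangent_space[OF this openin_subtopology_self assms _ v, of 1]
  show "v \<bullet> p = 0" by (simp add: round_sphere_iff[symmetric])
next
  fix v assume "v \<in> {v. v \<bullet> p = 0}"
  then have v: "p \<bullet> p = 1" "v \<bullet> p = 0" using assms by (auto simp: norm_eq_1)
  show "v \<in> tangent_space round_sphere p"
  proof -
    define c where "c t = (1 + t\<^sup>2 * (v \<bullet> v)) powr (-1/2) *\<^sub>R (p + t *\<^sub>R v)" for t :: real
    note c = normalized_line[OF v, folded c_def]
    have "smooth_on {-1<..<1} c"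
      using c(1) by (intro smooth_on_openI[of UNIV]) auto
    moreover have "c ` {-1<..<1} \<subseteq> round_sphere"
      using c(2) by (auto simp: norm_eq_1)
    ultimately show ?thesis
      using c(3,4) unfolding tangent_space_def by (intro CollectI exI[of _ c] exI[of _ 1]) auto
  qed
qed

abbreviation (input) T1 :: "('a::euclidean_space \<times> 'a) set" where
  "T1 \<equiv> unit_tangent_bundle round_sphere round_metric"

lemma T1_iff: "(q, u) \<in> T1 \<longleftrightarrow> q \<bullet> q = 1 \<and> u \<bullet> q = 0 \<and> u \<bullet> u = 1"
proof (cases "q \<in> round_sphere")
  case True
  then show ?thesis
    using tangent_space_round_sphere[OF True] round_sphere_iff[of q]
    by (simp add: unit_tangent_bundle_def del: mem_sphere_0)
next
  case False
  then show ?thesis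
    using round_sphere_iff[of q] by (simp add: unit_tangent_bundle_def del: mem_sphere_0)
qed

text \<open>Differentiating the three equations that define \<open>T1\<close> gives one inclusion.
  Conversely, \<open>(x, y)\<close> is the velocity of the curve that Gram-Schmidt makes of
  \<open>q + t *\<^sub>R x\<close> and \<open>u + t *\<^sub>R y\<close>.\<close>

lemma tangent_space_T1:
  fixes q u :: "'a::euclidean_space"
  assumes "(q, u) \<in> T1"
  shows "tangent_space T1 (q, u) = {(x, y). x \<bullet> q = 0 \<and> y \<bullet> u = 0 \<and> x \<bullet> u + y \<bullet> q = 0}"
proof (intro equalityI subsetI; clarify)
  fix x y assume v: "(x, y) \<in> tangent_space T1 (q, u)"
  have "((\<lambda>Q. fst Q \<bullet> fst Q) has_derivative (\<lambda>h. 2 * (fst h \<bullet> q))) (at (q, u) within T1)"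
    "((\<lambda>Q. snd Q \<bullet> snd Q) has_derivative (\<lambda>h. 2 * (snd h \<bullet> u))) (at (q, u) within T1)"
    "((\<lambda>Q. fst Q \<bullet> snd Q) has_derivative (\<lambda>h. fst h \<bullet> u + snd h \<bullet> q)) (at (q, u) within T1)"
    by (auto intro!: derivative_eq_intros simp: inner_commute)
  note this[THEN has_derivative_const_on_tangent_space[OF _ openin_subtopology_self assms _ v]]
  from this(1)[of 1] this(2)[of 1] this(3)[of 0]
  show "x \<bullet> q = 0 \<and> y \<bullet> u = 0 \<and> x \<bullet> u + y \<bullet> q = 0"
    by (auto simp: T1_iff inner_commute)
next
  fix x y assume v: "x \<bullet> q = 0" "y \<bullet> u = 0" "x \<bullet> u + y \<bullet> q = 0"
  have qu: "q \<bullet> q = 1" "u \<bullet> q = 0" "u \<bullet> u = 1" using assms by (auto simp: T1_iff)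
  define c where "c t = (1 + t\<^sup>2 * (x \<bullet> x)) powr (-1/2) *\<^sub>R (q + t *\<^sub>R x)" for t :: real
  note c = normalized_line[OF qu(1) v(1), folded c_def]
  define w where "w t = (u + t *\<^sub>R y) - ((u + t *\<^sub>R y) \<bullet> c t) *\<^sub>R c t" for t
  define d where "d t = (w t \<bullet> w t) powr (-1/2) *\<^sub>R w t" for t
  have "C_k_on k (\<lambda>t::real. t) UNIV" for k by (intro C_k_on_linear bounded_linear_ident) auto
  then have w: "C_k_on k w UNIV" for k
    unfolding w_def using c(1)
    by (intro C_k_on_diff C_k_on_scaleR C_k_on_add C_k_on_inner C_k_on_const) auto
  have w0: "w 0 = u" using c(3) qu by (simp add: w_def)
  have orth: "w t \<bullet> c t = 0" for t using c(2) by (simp add: w_def inner_diff_left)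
  have "continuous_on UNIV w" using w[of 0] by simp
  \<comment> \<open>Only near 0 is \<open>w\<close> known to be nonzero, so the normalised curve is
    taken on a short interval.\<close>
  then have "open {t. w t \<bullet> w t > 0}"
    by (intro open_Collect_less continuous_intros)
  moreover have "0 \<in> {t. w t \<bullet> w t > 0}" using w0 qu(3) by (simp del: inner_gt_zero_iff)
  ultimately obtain e where e: "e > 0" "ball 0 e \<subseteq> {t. w t \<bullet> w t > 0}"
    using open_contains_ball by blast
  then have pos: "w t \<bullet> w t > 0" if "t \<in> {-e<..<e}" for t
    using that by (auto simp: subset_iff dist_real_def)
  have "C_k_on k d {-e<..<e}" for k
    unfolding d_def using pos C_k_on_subset[OF w]
    by (intro C_k_on_scaleR C_k_on_compose[OF _ _ _ C_k_on_powr] C_k_on_inner) auto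
  moreover have "C_k_on k c {-e<..<e}" for k using c(1) by (rule C_k_on_subset) auto
  ultimately have "smooth_on {-e<..<e} (\<lambda>t. (c t, d t))"
    by (intro smooth_on_openI[of "{-e<..<e}"] C_k_on_Pair) auto
  moreover have "(c t, d t) \<in> T1" if "t \<in> {-e<..<e}" for t
  proof -
    have "(w t \<bullet> w t) powr (-1/2) * (w t \<bullet> w t) powr (-1/2) = inverse (w t \<bullet> w t)"
      using pos[OF that] powr_add[of "w t \<bullet> w t" "-1/2" "-1/2"] by (simp add: powr_minus)
    then show ?thesis
      using c(2) orth pos[OF that] by (simp add: T1_iff d_def mult.assoc[symmetric])
  qed
  moreover have "(c t, d t) = (q, u)" if "t = 0" for t
    using that c(3) w0 qu by (simp add: d_def)
  moreover have "((\<lambda>t. (c t, d t)) has_vector_derivative (x, y)) (at 0)"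
  proof -
    have c': "(c has_derivative (\<lambda>t. t *\<^sub>R x)) (at 0)"
      using c(4) by (simp add: has_vector_derivative_def)
    have b': "((\<lambda>t. u + t *\<^sub>R y) has_derivative (\<lambda>t. t *\<^sub>R y)) (at 0)"
      by (auto intro!: derivative_eq_intros)
    \<comment> \<open>This tangency equation makes the projection coefficient
      \<open>(u + t *\<^sub>R y) \<bullet> c t\<close> vanish to first order at 0, so that the
      correction in \<open>w\<close> leaves the velocity \<open>y\<close> intact.\<close>
    have yq: "y \<bullet> q = - (u \<bullet> x)" using v(3) by (simp add: inner_commute)
    have "(w has_derivative (\<lambda>t. t *\<^sub>R y)) (at 0)"
      unfolding w_def
      by (rule has_derivative_eq_rhs, rule has_derivative_diff[OF b'
            has_derivative_scaleR[OF has_derivative_inner[OF b' c'] c']])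
        (use c(3) qu v(1,2) yq in \<open>auto simp: inner_commute algebra_simps\<close>)
    then have w': "(w has_vector_derivative y) (at 0)" by (simp add: has_vector_derivative_def)
    have "((\<lambda>t. w t \<bullet> w t) has_real_derivative 0) (at 0)"
      unfolding has_field_derivative_def
      by (rule has_derivative_eq_rhs, rule has_derivative_inner)
        (use w' w0 v in \<open>auto simp: has_vector_derivative_def inner_commute\<close>)
    then have "((\<lambda>t. (w t \<bullet> w t) powr (-1/2)) has_real_derivative 0) (at 0)"
      by (rule has_derivative_powr_at_1) (use w0 qu in simp)
    from has_vector_derivative_scaleR[OF this w'] have "(d has_vector_derivative y) (at 0)"
      using w0 qu by (simp add: d_def[abs_def])
    then show ?thesis using c(4) by (rule_tac has_vector_derivative_Pair)
  qed
  ultimately show "(x, y) \<in> tangent_space T1 (q, u)"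
    unfolding tangent_space_def using e(1)
    by (intro CollectI exI[of _ "\<lambda>t. (c t, d t)"] exI[of _ e]) auto
qed

section \<open>The Koszul formula\<close>

lemma vector_field_onD:
  assumes "vector_field_on M S X"
  shows "openin (top_of_set M) S" "smooth_on S X" "\<And>p. p \<in> S \<Longrightarrow> X p \<in> tangent_space M p"
  using assms by (auto simp: vector_field_on_def)

lemma levi_civita_connectionD:
  assumes "levi_civita_connection M g D"
    and "vector_field_on M S X" "vector_field_on M S Y" "vector_field_on M S Z"
  shows "vector_field_on M S (D X Y)"
    and "p \<in> S \<Longrightarrow> D X Y p - D Y X p = lie_bracket M X Y p"
    and "p \<in> S \<Longrightarrow> deriv_along M p (X p) (\<lambda>q. g q (Y q) (Z q)) =
      g p (D X Y p) (Z p) + g p (Y p) (D X Z p)"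
proof -
  \<comment> \<open>\<open>affine_connection\<close> quantifies over a smooth function too, so its
    closure statement needs some instance of it.\<close>
  have "smooth_on S (\<lambda>_. 0 :: real)"
    by (rule smooth_on_openI[of UNIV]) (auto intro: C_k_on_const)
  then show "vector_field_on M S (D X Y)"
    using assms unfolding levi_civita_connection_def affine_connection_def by meson
  show "p \<in> S \<Longrightarrow> D X Y p - D Y X p = lie_bracket M X Y p"
    and "p \<in> S \<Longrightarrow> deriv_along M p (X p) (\<lambda>q. g q (Y q) (Z q)) =
      g p (D X Y p) (Z p) + g p (Y p) (D X Z p)"
    using assms unfolding levi_civita_connection_def by meson+
qed

text \<open>Here \<open>G\<close> extends the metric bilinearly to ambient vectors and \<open>H h\<close> is the derivative
  of \<open>Q \<mapsto> G Q\<close> in the direction \<open>h\<close>.\<close>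

lemma koszul:
  fixes M :: "'a::euclidean_space set" and G :: "'a \<Rightarrow> 'a \<Rightarrow> 'a \<Rightarrow> real"
  assumes LC: "levi_civita_connection M g D"
    and X: "vector_field_on M S X" and Y: "vector_field_on M S Y" and Z: "vector_field_on M S Z"
    and p: "p \<in> S"
    and G: "\<And>Q v w. Q \<in> S \<Longrightarrow> v \<in> tangent_space M Q \<Longrightarrow> w \<in> tangent_space M Q \<Longrightarrow> g Q v w = G Q v w"
    and bil: "bilinear (G p)" and sym: "\<And>v w. G p v w = G p w v"
    and dG: "\<And>V W V' W'. (V has_derivative V') (at p within M) \<Longrightarrow>
      (W has_derivative W') (at p within M) \<Longrightarrow>
      ((\<lambda>Q. G Q (V Q) (W Q)) has_derivative
        (\<lambda>h. H h (V p) (W p) + G p (V' h) (W p) + G p (V p) (W' h))) (at p within M)"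
    and Y': "(Y has_derivative Y') (at p within M)"
  shows "2 * G p (D X Y p) (Z p) =
    2 * G p (Y' (X p)) (Z p) + H (X p) (Y p) (Z p) + H (Y p) (X p) (Z p) - H (Z p) (X p) (Y p)"
proof -
  note LCD = levi_civita_connectionD[OF LC]
  note bl = bilinear_ladd[OF bil] bilinear_radd[OF bil] bilinear_lsub[OF bil] bilinear_rsub[OF bil]
  obtain X' where X': "(X has_derivative X') (at p within M)"
    using smooth_on_has_derivative[OF vector_field_onD(2,1)[OF X] p] by metis
  obtain Z' where Z': "(Z has_derivative Z') (at p within M)"
    using smooth_on_has_derivative[OF vector_field_onD(2,1)[OF Z] p] by metis
  have metric: "H (A p) (B p) (C p) + G p (B' (A p)) (C p) + G p (B p) (C' (A p)) =
      G p (D A B p) (C p) + G p (B p) (D A C p)"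
    if A: "vector_field_on M S A" and B: "vector_field_on M S B" and C: "vector_field_on M S C"
      and B': "(B has_derivative B') (at p within M)" and C': "(C has_derivative C') (at p within M)"
    for A B C B' C'
  proof -
    have "((\<lambda>Q. g Q (B Q) (C Q)) has_derivative
        (\<lambda>h. H h (B p) (C p) + G p (B' h) (C p) + G p (B p) (C' h))) (at p within M)"
      using G vector_field_onD(3)[OF B] vector_field_onD(3)[OF C]
      by (intro has_derivative_transform_openin[OF dG[OF B' C'] vector_field_onD(1)[OF A] p]) auto
    from deriv_along_eq[OF this vector_field_onD(3)[OF A p]]
    show ?thesis
      using LCD(3)[OF A B C p] G[OF p] vector_field_onD(3)[OF _ p] A B C LCD(1)[OF A B C]
        LCD(1)[OF A C B] by auto
  qed
  have torsion: "D A B p - D B A p = B' (A p) - A' (B p)"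
    if A: "vector_field_on M S A" and B: "vector_field_on M S B"
      and A': "(A has_derivative A') (at p within M)" and B': "(B has_derivative B') (at p within M)"
    for A B A' B'
    using LCD(2)[OF A B A p] deriv_along_eq[OF B' vector_field_onD(3)[OF A p]]
      deriv_along_eq[OF A' vector_field_onD(3)[OF B p]]
    by (simp add: lie_bracket_def)
  \<comment> \<open>In the sum of the metric identities for \<open>X Y Z\<close> and
    \<open>Y X Z\<close> minus that for \<open>Z X Y\<close>, with brackets written as ambient
    derivatives, all terms in \<open>X'\<close> and \<open>Z'\<close> cancel. Apart from
    \<open>Y'\<close>, what is left is a Christoffel symbol of the first kind.\<close>
  have "G p (D X Y p) (Z p) - G p (D Y X p) (Z p) = G p (Y' (X p)) (Z p) - G p (X' (Y p)) (Z p)"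
    using torsion[OF X Y X' Y'] by (metis bl(3))
  moreover have "G p (Y p) (D X Z p) - G p (Y p) (D Z X p) = G p (Y p) (Z' (X p)) - G p (Y p) (X' (Z p))"
    using torsion[OF X Z X' Z'] by (metis bl(4))
  moreover have "G p (X p) (D Y Z p) - G p (X p) (D Z Y p) = G p (X p) (Z' (Y p)) - G p (X p) (Y' (Z p))"
    using torsion[OF Y Z Y' Z'] by (metis bl(4))
  ultimately show ?thesis
    using metric[OF X Y Z Y' Z'] metric[OF Y X Z X' Z'] metric[OF Z X Y X' Y']
      sym[of "D Z X p" "Y p"] sym[of "X' (Z p)" "Y p"]
    by linarith
qed

section \<open>The round sphere\<close>

text \<open>For \<open>z\<close> orthogonal to a point the field has the value \<open>z\<close>
  there, so every tangent vector extends to a field on all of \<open>S\<close>.\<close>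

lemma vector_field_round_sphere_const:
  assumes "openin (top_of_set round_sphere) S"
  shows "vector_field_on round_sphere S (\<lambda>p. z - (z \<bullet> p) *\<^sub>R p)"
  unfolding vector_field_on_def
proof (intro conjI ballI)
  have "C_k_on k (\<lambda>p. p) UNIV" for k by (intro C_k_on_linear bounded_linear_ident) auto
  then show "smooth_on S (\<lambda>p. z - (z \<bullet> p) *\<^sub>R p)"
    by (intro smooth_on_openI[of UNIV] C_k_on_diff C_k_on_scaleR C_k_on_inner C_k_on_const) auto
  fix p assume "p \<in> S"
  then have p: "p \<in> round_sphere" using assms by (auto simp: openin_open)
  then have "p \<bullet> p = 1" by (simp only: round_sphere_iff)
  then show "z - (z \<bullet> p) *\<^sub>R p \<in> tangent_space round_sphere p"
    by (simp add: tangent_space_round_sphere[OF p] inner_diff_left)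
qed (rule assms)

lemma vector_field_round_sphere_orth:
  assumes "vector_field_on round_sphere S X" "p \<in> S"
  shows "X p \<bullet> p = 0" "p \<bullet> p = 1"
proof -
  have p: "p \<in> round_sphere" using assms by (auto simp: vector_field_on_def openin_open)
  then show "p \<bullet> p = 1" by (simp only: round_sphere_iff)
  show "X p \<bullet> p = 0"
    using vector_field_onD(3)[OF assms] tangent_space_round_sphere[OF p] by simp
qed

text \<open>The Gauss formula: the right side is the tangential part of the ambient derivative, its
  normal part being known from differentiating \<open>Y q \<bullet> q = 0\<close>.\<close>

lemma levi_civita_round_sphere:
  assumes LC: "levi_civita_connection round_sphere round_metric nabla"
    and X: "vector_field_on round_sphere S X" and Y: "vector_field_on round_sphere S Y"
    and p: "p \<in> S" and Y': "(Y has_derivative Y') (at p within round_sphere)"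
  shows "nabla X Y p = Y' (X p) + (X p \<bullet> Y p) *\<^sub>R p"
proof -
  define r where "r = nabla X Y p - (Y' (X p) + (X p \<bullet> Y p) *\<^sub>R p)"
  note op = vector_field_onD(1)[OF X]
  have pp: "p \<bullet> p = 1" using vector_field_round_sphere_orth[OF X p] by simp
  have "((\<lambda>q. Y q \<bullet> q) has_derivative (\<lambda>h. Y p \<bullet> h + Y' h \<bullet> p)) (at p within round_sphere)"
    using Y' by (auto intro!: derivative_eq_intros)
  from has_derivative_const_on_tangent_space[OF this op p _ vector_field_onD(3)[OF X p], of 0]
  have "Y p \<bullet> X p + Y' (X p) \<bullet> p = 0"
    using vector_field_round_sphere_orth[OF Y] by auto
  moreover have "nabla X Y p \<bullet> p = 0"
    using vector_field_round_sphere_orth[OF levi_civita_connectionD(1)[OF LC X Y X] p] by simp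
  ultimately have rp: "r \<bullet> p = 0"
    using pp by (simp add: r_def inner_simps inner_commute)
  define Z where "Z q = r - (r \<bullet> q) *\<^sub>R q" for q
  have Z: "vector_field_on round_sphere S Z"
    unfolding Z_def by (rule vector_field_round_sphere_const[OF op])
  \<comment> \<open>The inner product does not depend on the point, so its derivative
    \<open>H\<close> is zero.\<close>
  have "2 * (nabla X Y p \<bullet> Z p) = 2 * (Y' (X p) \<bullet> Z p) + 0 + 0 - 0"
    by (rule koszul[OF LC X Y Z p, where H = "\<lambda>_ _ _. 0"])
      (auto intro!: bilinear_conv_bounded_bilinear[THEN iffD2] bounded_bilinear_inner
        derivative_eq_intros Y' simp: inner_commute)
  then have 1: "nabla X Y p \<bullet> r = Y' (X p) \<bullet> r"
    using rp by (simp add: Z_def)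
  have 2: "r \<bullet> v = nabla X Y p \<bullet> v - Y' (X p) \<bullet> v - (X p \<bullet> Y p) * (p \<bullet> v)" for v
    by (simp add: r_def inner_simps)
  have "r \<bullet> r = 0"
    using 1 2[of r] rp inner_commute[of p r] by simp
  then show ?thesis by (simp add: r_def)
qed

section \<open>The Sasaki metric on the unit tangent bundle of the sphere\<close>

text \<open>A section \<open>Y\<close> through \<open>(q, u)\<close> that is parallel along
  \<open>x\<close> satisfies \<open>Y' x + (x \<bullet> u) *\<^sub>R q = 0\<close>, which fixes its
  differential on \<open>x\<close> independently of \<open>Y\<close>. Projected constants provide
  one such section.\<close>

lemma horizontal_lift_round_sphere:
  assumes LC: "levi_civita_connection round_sphere round_metric nabla"
    and q: "q \<bullet> q = 1" and u: "u \<bullet> q = 0" and x: "x \<bullet> q = 0"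
  shows "horizontal_lift round_sphere nabla (q, u) x = (x, - (u \<bullet> x) *\<^sub>R q)"
  unfolding horizontal_lift_def fst_conv snd_conv
proof (rule the_equality)
  have qS: "q \<in> round_sphere" using q by (simp only: round_sphere_iff)
  have xT: "x \<in> tangent_space round_sphere q" using x by (simp add: tangent_space_round_sphere[OF qS])
  have along: "deriv_along round_sphere q x (\<lambda>y. (y, Y y)) = (x, Y' x)"
    if "(Y has_derivative Y') (at q within round_sphere)" for Y Y'
    by (rule deriv_along_eq[OF _ xT, of _ "\<lambda>h. (h, Y' h)"])
      (intro has_derivative_Pair has_derivative_ident that)
  {
    define X where "X p = x - (x \<bullet> p) *\<^sub>R p" for p
    define Y where "Y p = u - (u \<bullet> p) *\<^sub>R p" for p
    have V: "vector_field_on round_sphere round_sphere X" "vector_field_on round_sphere round_sphere Y"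
      unfolding X_def Y_def by (intro vector_field_round_sphere_const openin_subtopology_self)+
    have Y': "(Y has_derivative (\<lambda>h. - (u \<bullet> h) *\<^sub>R q)) (at q within round_sphere)"
      unfolding Y_def[abs_def] using u by (auto intro!: derivative_eq_intros)
    have "X q = x" "Y q = u" using x u by (simp_all add: X_def Y_def)
    moreover have "nabla X Y q = 0"
      using levi_civita_round_sphere[OF LC V qS Y'] \<open>X q = x\<close> \<open>Y q = u\<close> by (simp add: inner_commute)
    ultimately show "\<exists>S X Y. vector_field_on round_sphere S X \<and> vector_field_on round_sphere S Y \<and>
        q \<in> S \<and> X q = x \<and> Y q = u \<and> nabla X Y q = 0 \<and>
        (x, - (u \<bullet> x) *\<^sub>R q) = deriv_along round_sphere q x (\<lambda>y. (y, Y y))"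
      using V qS along[OF Y'] by (intro exI[of _ round_sphere] exI[of _ X] exI[of _ Y]) simp
  }
  fix w assume "\<exists>S X Y. vector_field_on round_sphere S X \<and> vector_field_on round_sphere S Y \<and>
        q \<in> S \<and> X q = x \<and> Y q = u \<and> nabla X Y q = 0 \<and>
        w = deriv_along round_sphere q x (\<lambda>y. (y, Y y))"
  then obtain S X Y where V: "vector_field_on round_sphere S X" "vector_field_on round_sphere S Y"
    "q \<in> S" and val: "X q = x" "Y q = u" "nabla X Y q = 0"
    and w: "w = deriv_along round_sphere q x (\<lambda>y. (y, Y y))"
    by blast
  obtain Y' where Y': "(Y has_derivative Y') (at q within round_sphere)"
    using smooth_on_has_derivative[OF vector_field_onD(2,1)[OF V(2)] V(3)] by metis
  have "Y' x + (x \<bullet> u) *\<^sub>R q = 0"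
    using levi_civita_round_sphere[OF LC V Y'] val by simp
  then show "w = (x, - (u \<bullet> x) *\<^sub>R q)"
    using along[OF Y'] w by (simp add: inner_commute eq_neg_iff_add_eq_0)
qed

definition sasaki_form :: "'a::euclidean_space \<times> 'a \<Rightarrow> 'a \<times> 'a \<Rightarrow> 'a \<times> 'a \<Rightarrow> real" where
  "sasaki_form Q v w = v \<bullet> w - (snd Q \<bullet> fst v) * (snd Q \<bullet> fst w)"

text \<open>A tangent vector \<open>(x, y)\<close> of \<open>T1\<close> has horizontal part
  \<open>x\<close> and vertical part \<open>y + (u \<bullet> x) *\<^sub>R q\<close>. In the product
  of two vertical parts \<open>y \<bullet> q = - (u \<bullet> x)\<close> applies, and the three
  terms involving \<open>q\<close> add up to
  \<open>- (u \<bullet> x) * (u \<bullet> x')\<close>.\<close>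

lemma sasaki_metric_round_sphere:
  assumes LC: "levi_civita_connection round_sphere round_metric nabla"
    and Q: "Q \<in> T1" and v: "v \<in> tangent_space T1 Q" and w: "w \<in> tangent_space T1 Q"
  shows "sasaki_metric round_sphere round_metric nabla Q v w = sasaki_form Q v w"
proof -
  obtain q u where Qe: "Q = (q, u)" by force
  obtain x y where ve: "v = (x, y)" by force
  obtain x' y' where we: "w = (x', y')" by force
  have q: "q \<bullet> q = 1" "u \<bullet> q = 0" "u \<bullet> u = 1" using Q by (auto simp: Qe T1_iff)
  have qS: "q \<in> round_sphere" using q by (simp only: round_sphere_iff)
  note T = tangent_space_round_sphere[OF qS]
  have xy: "x \<bullet> q = 0" "y \<bullet> q = - (u \<bullet> x)" "x' \<bullet> q = 0" "y' \<bullet> q = - (u \<bullet> x')"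
    using v w tangent_space_T1[of q u] Q by (auto simp: Qe ve we inner_commute)
  note lift = horizontal_lift_round_sphere[OF LC q(1,2)]
  have "(THE r. \<exists>a\<in>tangent_space round_sphere q. \<exists>b\<in>tangent_space round_sphere q.
             \<exists>a'\<in>tangent_space round_sphere q. \<exists>b'\<in>tangent_space round_sphere q.
        (x, y) = horizontal_lift round_sphere nabla (q, u) a + vertical_lift b \<and>
        (x', y') = horizontal_lift round_sphere nabla (q, u) a' + vertical_lift b' \<and>
        r = a \<bullet> a' + b \<bullet> b') = x \<bullet> x' + (y + (u \<bullet> x) *\<^sub>R q) \<bullet> (y' + (u \<bullet> x') *\<^sub>R q)"
  proof (rule the_equality)
    show "\<exists>a\<in>tangent_space round_sphere q. \<exists>b\<in>tangent_space round_sphere q.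
             \<exists>a'\<in>tangent_space round_sphere q. \<exists>b'\<in>tangent_space round_sphere q.
        (x, y) = horizontal_lift round_sphere nabla (q, u) a + vertical_lift b \<and>
        (x', y') = horizontal_lift round_sphere nabla (q, u) a' + vertical_lift b' \<and>
        x \<bullet> x' + (y + (u \<bullet> x) *\<^sub>R q) \<bullet> (y' + (u \<bullet> x') *\<^sub>R q) = a \<bullet> a' + b \<bullet> b'"
      using q xy lift by (intro bexI[of _ x] bexI[of _ "y + (u \<bullet> x) *\<^sub>R q"]
          bexI[of _ x'] bexI[of _ "y' + (u \<bullet> x') *\<^sub>R q"])
        (auto simp: T vertical_lift_def inner_add_left)
  qed (use lift in \<open>auto simp: T vertical_lift_def\<close>)
  moreover have "x \<bullet> x' + (y + (u \<bullet> x) *\<^sub>R q) \<bullet> (y' + (u \<bullet> x') *\<^sub>R q) = sasaki_form Q v w"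
    using q xy by (simp add: sasaki_form_def Qe ve we inner_simps inner_commute)
  ultimately show ?thesis
    by (simp add: sasaki_metric_def Qe ve we)
qed

lemma bilinear_sasaki_form: "bilinear (sasaki_form Q)"
  by (auto simp: bilinear_def sasaki_form_def inner_simps algebra_simps intro!: linearI)

lemma has_derivative_sasaki_form:
  assumes "(V has_derivative V') (at p within M)" "(W has_derivative W') (at p within M)"
  shows "((\<lambda>Q. sasaki_form Q (V Q) (W Q)) has_derivative
    (\<lambda>h. - (snd h \<bullet> fst (V p)) * (snd p \<bullet> fst (W p)) - (snd p \<bullet> fst (V p)) * (snd h \<bullet> fst (W p))
       + sasaki_form p (V' h) (W p) + sasaki_form p (V p) (W' h))) (at p within M)"
  unfolding sasaki_form_def
  by (auto intro!: derivative_eq_intros assms simp: algebra_simps)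

text \<open>The normal space of the unit tangent bundle at \<open>(q, u)\<close> is spanned by the orthogonal vectors
  \<open>(q, 0)\<close>, \<open>(0, u)\<close> and \<open>(u, q)\<close>, the last of length \<open>sqrt 2\<close>.\<close>

definition proj_T1 :: "'a::euclidean_space \<times> 'a \<Rightarrow> 'a \<times> 'a \<Rightarrow> 'a \<times> 'a" where
  "proj_T1 Q v =
     (let q = fst Q; u = snd Q; a = fst v; b = snd v; c = (1/2) * (a \<bullet> u + b \<bullet> q)
      in (a - (a \<bullet> q) *\<^sub>R q - c *\<^sub>R u, b - (b \<bullet> u) *\<^sub>R u - c *\<^sub>R q))"

lemma proj_T1_in_tangent_space:
  assumes "Q \<in> T1"
  shows "proj_T1 Q v \<in> tangent_space T1 Q"
proof -
  obtain q u where Q: "Q = (q, u)" by force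
  then have "q \<bullet> q = 1" "u \<bullet> q = 0" "q \<bullet> u = 0" "u \<bullet> u = 1"
    using assms by (auto simp: T1_iff inner_commute)
  then show ?thesis
    using tangent_space_T1[of q u] assms
    by (simp add: Q proj_T1_def Let_def inner_simps)
qed

lemma proj_T1_id:
  assumes "Q \<in> T1" "v \<in> tangent_space T1 Q"
  shows "proj_T1 Q v = v"
  using assms tangent_space_T1[of "fst Q" "snd Q"] by (auto simp: proj_T1_def)

lemma vector_field_proj_T1:
  assumes "open W" "\<And>k. C_k_on k F W" "openin (top_of_set T1) S" "S \<subseteq> W"
  shows "vector_field_on T1 S (\<lambda>Q. proj_T1 Q (F Q))"
  unfolding vector_field_on_def
proof (intro conjI ballI)
  have lin: "C_k_on k fst W" "C_k_on k snd W" "C_k_on k (\<lambda>Q. fst (F Q)) W" "C_k_on k (\<lambda>Q. snd (F Q)) W" for k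
    using assms(1,2)
    by (auto intro: C_k_on_linear C_k_on_linear_image bounded_linear_fst bounded_linear_snd)
  show "smooth_on S (\<lambda>Q. proj_T1 Q (F Q))"
    unfolding proj_T1_def Let_def using assms(1,4) lin
    by (intro smooth_on_openI[of W] C_k_on_Pair C_k_on_diff C_k_on_scaleR C_k_on_mult
        C_k_on_add C_k_on_inner C_k_on_const) auto
  show "proj_T1 Q (F Q) \<in> tangent_space T1 Q" if "Q \<in> S" for Q
    using that assms(3) by (intro proj_T1_in_tangent_space) (auto simp: openin_open)
qed (rule assms)

text \<open>\<open>s\<close> and \<open>t\<close> are the horizontal and vertical parts. With
  \<open>a = x2 + (u \<bullet> x) *\<^sub>R q\<close> and
  \<open>b = y2 + (u \<bullet> y) *\<^sub>R q\<close>, the vertical parts of the two fields,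
  \<open>s\<close> is the covariant derivative on the sphere plus half of
  \<open>R(u, a) y + R(u, b) x\<close>, where \<open>R(v, w) z\<close> is
  \<open>(w \<bullet> z) *\<^sub>R v - (v \<bullet> z) *\<^sub>R w\<close>, the curvature of the
  unit sphere.\<close>

lemma levi_civita_T1:
  fixes q u :: "'a::euclidean_space"
  assumes LC: "levi_civita_connection round_sphere round_metric nabla"
    and LCT: "levi_civita_connection T1 (sasaki_metric round_sphere round_metric nabla) nablaT"
    and X: "vector_field_on T1 S X" and Y: "vector_field_on T1 S Y"
    and p: "(q, u) \<in> S" and Y': "(Y has_derivative Y') (at (q, u) within T1)"
    and Xp: "X (q, u) = (x, x2)" and Yp: "Y (q, u) = (y, y2)" and dY: "Y' (x, x2) = (d1, d2)"
  defines "s \<equiv> d1 + (x \<bullet> y) *\<^sub>R q + ((1/2) * (x2 \<bullet> y + y2 \<bullet> x)) *\<^sub>R u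
      - ((1/2) * (u \<bullet> y)) *\<^sub>R (x2 + (u \<bullet> x) *\<^sub>R q) - ((1/2) * (u \<bullet> x)) *\<^sub>R (y2 + (u \<bullet> y) *\<^sub>R q)"
    and "t \<equiv> d2 - (d2 \<bullet> q) *\<^sub>R q - (d2 \<bullet> u) *\<^sub>R u
      + (1/2) *\<^sub>R ((u \<bullet> y) *\<^sub>R x + (u \<bullet> x) *\<^sub>R y) - ((u \<bullet> x) * (u \<bullet> y)) *\<^sub>R u"
  shows "nablaT X Y (q, u) = (s, t - (u \<bullet> s) *\<^sub>R q)"
proof -
  note op = vector_field_onD(1)[OF X]
  have ST: "S \<subseteq> T1" using op by (auto simp: openin_open)
  then have pT: "(q, u) \<in> T1" using p by auto
  have q: "q \<bullet> q = 1" "u \<bullet> q = 0" "u \<bullet> u = 1" "q \<bullet> u = 0" using pT by (auto simp: T1_iff inner_commute)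
  note T = tangent_space_T1[OF pT]
  have xT: "(x, x2) \<in> tangent_space T1 (q, u)" and yT: "(y, y2) \<in> tangent_space T1 (q, u)"
    using vector_field_onD(3)[OF X p] vector_field_onD(3)[OF Y p] Xp Yp by auto
  have xy: "x \<bullet> q = 0" "x2 \<bullet> u = 0" "x2 \<bullet> q = - (x \<bullet> u)" "y \<bullet> q = 0" "y2 \<bullet> u = 0" "y2 \<bullet> q = - (y \<bullet> u)"
    using xT yT T by auto
  have tan: "fst (Y (a, b)) \<bullet> a = 0" "fst (Y (a, b)) \<bullet> b + snd (Y (a, b)) \<bullet> a = 0"
    if "(a, b) \<in> S" for a b
    using vector_field_onD(3)[OF Y that] tangent_space_T1[of a b] that ST by (cases "Y (a, b)"; auto)+
  \<comment> \<open>Differentiating the tangency conditions of \<open>Y\<close> along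
    \<open>X\<close> expresses normal components of \<open>(d1, d2)\<close> through the values of
    the fields.\<close>
  have d1q: "d1 \<bullet> q + y \<bullet> x = 0"
  proof -
    have "((\<lambda>Q. fst (Y Q) \<bullet> fst Q) has_derivative
        (\<lambda>h. fst (Y (q, u)) \<bullet> fst h + fst (Y' h) \<bullet> fst (q, u))) (at (q, u) within T1)"
      by (auto intro!: derivative_eq_intros Y')
    from has_derivative_const_on_tangent_space[OF this op p _ xT, of 0] show ?thesis
      using tan dY Yp by auto
  qed
  have d12: "d1 \<bullet> u + y \<bullet> x2 + d2 \<bullet> q + y2 \<bullet> x = 0"
  proof -
    have "((\<lambda>Q. fst (Y Q) \<bullet> snd Q + snd (Y Q) \<bullet> fst Q) has_derivative
        (\<lambda>h. (fst (Y (q, u)) \<bullet> snd h + fst (Y' h) \<bullet> snd (q, u))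
           + (snd (Y (q, u)) \<bullet> fst h + snd (Y' h) \<bullet> fst (q, u)))) (at (q, u) within T1)"
      by (auto intro!: derivative_eq_intros Y')
    from has_derivative_const_on_tangent_space[OF this op p _ xT, of 0] show ?thesis
      using tan dY Yp by auto
  qed
  obtain s0 t0 where D: "nablaT X Y (q, u) = (s0, t0)" by force
  have "(s0, t0) \<in> tangent_space T1 (q, u)"
    using vector_field_onD(3)[OF levi_civita_connectionD(1)[OF LCT X Y X] p] D by simp
  then have st0: "s0 \<bullet> q = 0" "t0 \<bullet> u = 0" "t0 \<bullet> q = - (s0 \<bullet> u)" using T by auto
  \<comment> \<open>\<open>e\<close> and \<open>f\<close> are the discrepancies of the horizontal
    and vertical parts, and \<open>z\<close> below is the tangent vector with exactly these parts.
    Tested against it, the Koszul formula reads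
    \<open>e \<bullet> e + f \<bullet> f = 0\<close>.\<close>
  define e where "e = s0 - s"
  define f where "f = t0 + (u \<bullet> s0) *\<^sub>R q - t"
  have e: "e \<bullet> q = 0"
    using q xy st0 d1q by (simp add: e_def s_def inner_simps inner_commute)
  have f: "f \<bullet> q = 0" "f \<bullet> u = 0"
    using q xy st0 by (simp_all add: f_def t_def inner_simps inner_commute)
  define z where "z = (e, f - (u \<bullet> e) *\<^sub>R q)"
  have zT: "z \<in> tangent_space T1 (q, u)"
    using e f q by (simp add: T z_def inner_simps inner_commute)
  define Z where "Z Q = proj_T1 Q z" for Q
  have Z: "vector_field_on T1 S Z"
    unfolding Z_def by (rule vector_field_proj_T1[of UNIV]) (auto intro: C_k_on_const op)
  have Zp: "Z (q, u) = z" using proj_T1_id[OF pT zT] by (simp add: Z_def)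
  define H where "H h v w = - (snd h \<bullet> fst v) * (u \<bullet> fst w) - (u \<bullet> fst v) * (snd h \<bullet> fst w)"
    for h v w :: "'a \<times> 'a"
  have metric: "sasaki_metric round_sphere round_metric nabla Q v w = sasaki_form Q v w"
    if "Q \<in> S" "v \<in> tangent_space T1 Q" "w \<in> tangent_space T1 Q" for Q v w
    using sasaki_metric_round_sphere[OF LC] that ST by blast
  have sym: "sasaki_form (q, u) v w = sasaki_form (q, u) w v" for v w
    by (simp add: sasaki_form_def inner_commute)
  have dG: "((\<lambda>Q. sasaki_form Q (V Q) (W Q)) has_derivative
      (\<lambda>h. H h (V (q, u)) (W (q, u)) + sasaki_form (q, u) (V' h) (W (q, u))
        + sasaki_form (q, u) (V (q, u)) (W' h))) (at (q, u) within T1)"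
    if "(V has_derivative V') (at (q, u) within T1)" "(W has_derivative W') (at (q, u) within T1)"
    for V W V' W'
    using has_derivative_sasaki_form[OF that] by (simp add: H_def)
  have "2 * sasaki_form (q, u) (s0, t0) z = 2 * sasaki_form (q, u) (d1, d2) z
    + H (x, x2) (y, y2) z + H (y, y2) (x, x2) z - H z (x, x2) (y, y2)"
    using koszul[where G = sasaki_form and H = H, OF LCT X Y Z p metric bilinear_sasaki_form sym dG Y']
    unfolding D Xp Yp dY Zp .
  then have K: "2 * (s0 \<bullet> e + t0 \<bullet> f) = 2 * (d1 \<bullet> e + d2 \<bullet> f - (u \<bullet> e) * (d2 \<bullet> q + u \<bullet> d1))
    - (x2 \<bullet> y) * (u \<bullet> e) - (u \<bullet> y) * (x2 \<bullet> e) - (y2 \<bullet> x) * (u \<bullet> e) - (u \<bullet> x) * (y2 \<bullet> e)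
    + (f \<bullet> x) * (u \<bullet> y) + (u \<bullet> x) * (f \<bullet> y)"
    using st0 xy
    by (simp add: H_def z_def sasaki_form_def inner_simps inner_commute algebra_simps)
  have w: "d2 \<bullet> q + u \<bullet> d1 = - (x2 \<bullet> y) - (y2 \<bullet> x)"
    using d12 by (simp add: inner_commute)
  have se: "s \<bullet> e = d1 \<bullet> e + (1/2) * (x2 \<bullet> y + y2 \<bullet> x) * (u \<bullet> e)
      - (1/2) * (u \<bullet> y) * (x2 \<bullet> e) - (1/2) * (u \<bullet> x) * (y2 \<bullet> e)"
    using e by (simp add: s_def inner_simps inner_commute)
  have tf: "t \<bullet> f = d2 \<bullet> f + (1/2) * (u \<bullet> y) * (f \<bullet> x) + (1/2) * (u \<bullet> x) * (f \<bullet> y)"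
    using f by (simp add: t_def inner_simps inner_commute)
  have ev: "e \<bullet> v = s0 \<bullet> v - s \<bullet> v"
    and fv: "f \<bullet> v = t0 \<bullet> v + (u \<bullet> s0) * (q \<bullet> v) - t \<bullet> v" for v
    by (simp_all add: e_def f_def inner_simps)
  have "e \<bullet> e + f \<bullet> f = (s0 \<bullet> e + t0 \<bullet> f) - s \<bullet> e - t \<bullet> f"
    using ev[of e] fv[of f] f inner_commute[of f q] by simp
  also have "\<dots> = 0"
    using K unfolding w se tf by (simp add: algebra_simps)
  finally have "e = 0" "f = 0"
    by (simp_all add: add_nonneg_eq_0_iff)
  then show ?thesis
    using D by (simp add: e_def f_def algebra_simps)
qed

section \<open>Second fundamental forms\<close>

text \<open>\<open>L\<close> carries the metric to the Euclidean inner product, where orthogonal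
  decomposition yields a normal component. It is unique because \<open>L\<close> is injective, so
  the definite description denotes it.\<close>

lemma second_fundamental_form_eq_0_iff:
  fixes L :: "'a::euclidean_space \<Rightarrow> 'b::euclidean_space"
  assumes N: "subspace (tangent_space N p)" "tangent_space N p \<subseteq> tangent_space M p"
    and M: "subspace (tangent_space M p)"
    and L: "linear L" "\<And>v. L v = 0 \<Longrightarrow> v = 0"
    and g: "\<And>v w. v \<in> tangent_space M p \<Longrightarrow> w \<in> tangent_space M p \<Longrightarrow> g p v w = L v \<bullet> L w"
    and D: "D X Y p \<in> tangent_space M p"
  shows "second_fundamental_form M g D N X Y p = 0 \<longleftrightarrow> D X Y p \<in> tangent_space N p"
proof -
  define P where "P w \<longleftrightarrow> w \<in> tangent_space M p \<and> (\<forall>z\<in>tangent_space N p. g p w z = 0) \<and>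
      D X Y p - w \<in> tangent_space N p" for w
  have "subspace (L ` tangent_space N p)" by (rule linear_subspace_image[OF L(1) N(1)])
  then have span: "span (L ` tangent_space N p) = L ` tangent_space N p" by (simp add: span_eq_iff)
  obtain y z where y: "y \<in> span (L ` tangent_space N p)"
    and z: "\<And>w. w \<in> span (L ` tangent_space N p) \<Longrightarrow> orthogonal z w"
    and yz: "L (D X Y p) = y + z"
    using orthogonal_subspace_decomp_exists[of "L ` tangent_space N p" "L (D X Y p)"] by metis
  obtain v where v: "v \<in> tangent_space N p" "y = L v" using y span by auto
  have z_eq: "z = L (D X Y p - v)" using yz v(2) by (simp add: linear_diff[OF L(1)])
  have ex: "P (D X Y p - v)"
    unfolding P_def
  proof (intro conjI ballI)
    show wM: "D X Y p - v \<in> tangent_space M p" using D v N(2) M by (auto intro: subspace_diff)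
    show "g p (D X Y p - v) a = 0" if "a \<in> tangent_space N p" for a
      using g[OF wM, of a] z[of "L a"] that N(2) span z_eq by (auto simp: orthogonal_def)
    show "D X Y p - (D X Y p - v) \<in> tangent_space N p" using v by simp
  qed
  have unique: "w = w'" if "P w" "P w'" for w w'
  proof -
    have "(D X Y p - w') - (D X Y p - w) \<in> tangent_space N p"
      using that N(1) unfolding P_def by (blast intro: subspace_diff)
    then have d: "w - w' \<in> tangent_space N p" by simp
    then have "g p w (w - w') = 0" "g p w' (w - w') = 0"
      using that unfolding P_def by blast+
    then have "L w \<bullet> L (w - w') = 0" "L w' \<bullet> L (w - w') = 0"
      using g[of w "w - w'"] g[of w' "w - w'"] that d N(2) unfolding P_def by auto
    then have "L (w - w') \<bullet> L (w - w') = 0"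
      by (simp add: linear_diff[OF L(1)] inner_diff_left)
    then show "w = w'" using L(2)[of "w - w'"] by simp
  qed
  have the: "second_fundamental_form M g D N X Y p = (THE w. P w)"
    by (simp add: second_fundamental_form_def P_def)
  show ?thesis
  proof
    assume "second_fundamental_form M g D N X Y p = 0"
    then have "P 0" using theI[of P, OF ex unique[OF _ ex]] by (simp add: the)
    then show "D X Y p \<in> tangent_space N p" by (simp add: P_def)
  next
    assume *: "D X Y p \<in> tangent_space N p"
    have "P 0"
      unfolding P_def
    proof (intro conjI ballI)
      show 0: "0 \<in> tangent_space M p" by (rule subspace_0[OF M])
      show "g p 0 a = 0" if "a \<in> tangent_space N p" for a
        using g[OF 0, of a] that N(2) by (auto simp: linear_0[OF L(1)])
    qed (use * in simp)
    then show "second_fundamental_form M g D N X Y p = 0"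
      unfolding the by (rule the_equality) (rule unique[OF _ \<open>P 0\<close>])
  qed
qed

lemma subspace_tangent_space_T1:
  assumes "Q \<in> T1"
  shows "subspace (tangent_space T1 Q)"
proof -
  obtain q u where Q: "Q = (q, u)" by force
  have eq: "tangent_space T1 Q = {v. fst v \<bullet> q = 0 \<and> snd v \<bullet> u = 0 \<and> fst v \<bullet> u + snd v \<bullet> q = 0}"
    using tangent_space_T1[of q u] assms Q by auto
  show ?thesis
    unfolding eq subspace_def
  proof (intro conjI ballI allI CollectI)
    fix c :: real and v assume v: "v \<in> {v. fst v \<bullet> q = 0 \<and> snd v \<bullet> u = 0 \<and> fst v \<bullet> u + snd v \<bullet> q = 0}"
    then show "fst (c *\<^sub>R v) \<bullet> u + snd (c *\<^sub>R v) \<bullet> q = 0"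
      by (simp add: distrib_left[symmetric])
  qed (auto simp: inner_add_left)
qed

lemma second_fundamental_form_T1_eq_0_iff:
  assumes LC: "levi_civita_connection round_sphere round_metric nabla"
    and N: "subspace (tangent_space N Q)" "N \<subseteq> T1" and Q: "Q \<in> T1"
    and D: "D X Y Q \<in> tangent_space T1 Q"
  shows "second_fundamental_form T1 (sasaki_metric round_sphere round_metric nabla) D N X Y Q = 0
    \<longleftrightarrow> D X Y Q \<in> tangent_space N Q"
proof -
  obtain q u where Qe: "Q = (q, u)" by force
  have q: "q \<bullet> q = 1" "u \<bullet> q = 0" "u \<bullet> u = 1" using Q by (auto simp: Qe T1_iff)
  \<comment> \<open>Horizontal and vertical part of \<open>v\<close>: in these coordinates the
    Sasaki metric on tangent vectors is the Euclidean one.\<close>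
  define L where "L v = (fst v, snd v + (u \<bullet> fst v) *\<^sub>R q)" for v
  have "linear L" by (auto simp: L_def inner_simps algebra_simps intro!: linearI)
  moreover have "v = 0" if "L v = 0" for v using that by (cases v) (auto simp: L_def prod_eq_iff)
  moreover have "sasaki_metric round_sphere round_metric nabla Q v w = L v \<bullet> L w"
    if "v \<in> tangent_space T1 Q" "w \<in> tangent_space T1 Q" for v w
  proof -
    obtain x y where ve: "v = (x, y)" by force
    obtain x' y' where we: "w = (x', y')" by force
    have "y \<bullet> q = - (u \<bullet> x)" "y' \<bullet> q = - (u \<bullet> x')"
      using that tangent_space_T1[of q u] Q by (auto simp: Qe ve we inner_commute)
    then have "L v \<bullet> L w = sasaki_form Q v w"
      using q by (simp add: L_def sasaki_form_def Qe ve we inner_simps inner_commute)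
    then show ?thesis using sasaki_metric_round_sphere[OF LC Q that] by simp
  qed
  ultimately show ?thesis
    using N(1) tangent_space_mono[OF N(2)] subspace_tangent_space_T1[OF Q] D
    by (rule_tac second_fundamental_form_eq_0_iff)
qed

section \<open>The image of a unit vector field\<close>

lemma at_within_openin:
  assumes "openin (top_of_set M) S" "p \<in> S"
  shows "at p within S = at p within M"
proof -
  obtain T where T: "open T" "S = M \<inter> T" using assms(1) by (auto simp: openin_open)
  show ?thesis by (rule at_within_nhd[of p T]) (use T assms(2) in auto)
qed

text \<open>The extension \<open>\<Xi>\<close> singles out one ambient linear map \<open>J q\<close>
  as derivative of \<open>\<xi>\<close> and can be differentiated a second time.\<close>

locale unit_field_germ =
  fixes nabla :: "('a::euclidean_space \<Rightarrow> 'a) \<Rightarrow> ('a \<Rightarrow> 'a) \<Rightarrow> 'a \<Rightarrow> 'a"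
    and \<xi> \<Xi> :: "'a \<Rightarrow> 'a" and U W :: "'a set"
  assumes LC: "levi_civita_connection round_sphere round_metric nabla"
    and field: "vector_field_on round_sphere U \<xi>"
    and unit: "\<And>q. q \<in> U \<Longrightarrow> norm (\<xi> q) = 1"
    and W: "open W" "W \<inter> round_sphere \<subseteq> U"
    and ext: "\<And>k. C_k_on k \<Xi> W" "\<And>q. q \<in> W \<inter> round_sphere \<Longrightarrow> \<Xi> q = \<xi> q"
begin

abbreviation "graph \<equiv> (\<lambda>q. (q, \<xi> q)) ` U"

definition J :: "'a \<Rightarrow> 'a \<Rightarrow> 'a" where
  "J q = frechet_derivative \<Xi> (at q)"

text \<open>For tangent \<open>v\<close> this is the covariant derivative of \<open>\<xi>\<close>
  along \<open>v\<close>, hence the negative of the shape operator.\<close>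

definition K :: "'a \<Rightarrow> 'a \<Rightarrow> 'a" where
  "K q v = J q v + (\<xi> q \<bullet> v) *\<^sub>R q"

text \<open>The second derivative of \<open>\<Xi>\<close>, with \<open>x\<close> the direction of
  the outer differentiation. The basis expansion makes linearity in \<open>y\<close>
  automatic.\<close>

definition J2 :: "'a \<Rightarrow> 'a \<Rightarrow> 'a \<Rightarrow> 'a" where
  "J2 q x y = (\<Sum>i\<in>Basis. (y \<bullet> i) *\<^sub>R frechet_derivative (\<lambda>p. J p i) (at q) x)"

text \<open>For tangent vectors \<open>x\<close>, \<open>y\<close>, this is the second covariant derivative of \<open>\<xi>\<close> up to multiples
  of \<open>q\<close> and of \<open>x\<close>; the correction \<open>(x \<bullet> y) J q q\<close> comes from the normal part \<open>- (x \<bullet> y) q\<close> of the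
  ambient derivative along \<open>x\<close> of a tangent field with value \<open>y\<close>.\<close>

definition B :: "'a \<Rightarrow> 'a \<Rightarrow> 'a \<Rightarrow> 'a" where
  "B q x y = J2 q x y - (x \<bullet> y) *\<^sub>R J q q"

text \<open>The covariant derivative of a field tangent to the graph is again tangent to it iff its
  vertical part is \<open>K q\<close> of its horizontal part. This is what remains of that condition
  after the derivative of the field has cancelled; the argument of \<open>K q\<close> on the right
  consists of the curvature terms in \<open>levi_civita_T1\<close>.\<close>

definition geodesic_eq :: "'a \<Rightarrow> 'a \<Rightarrow> 'a \<Rightarrow> bool" where
  "geodesic_eq q x y \<longleftrightarrow>
     B q x y - (B q x y \<bullet> q) *\<^sub>R q - (B q x y \<bullet> \<xi> q) *\<^sub>R \<xi> q
       + (1/2) *\<^sub>R ((\<xi> q \<bullet> y) *\<^sub>R x + (\<xi> q \<bullet> x) *\<^sub>R y) - ((\<xi> q \<bullet> x) * (\<xi> q \<bullet> y)) *\<^sub>R \<xi> q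
     = K q (((1/2) * (K q x \<bullet> y + K q y \<bullet> x)) *\<^sub>R \<xi> q
            - ((1/2) * (\<xi> q \<bullet> y)) *\<^sub>R K q x - ((1/2) * (\<xi> q \<bullet> x)) *\<^sub>R K q y)"

lemma J_has_derivative: "q \<in> W \<Longrightarrow> (\<Xi> has_derivative J q) (at q)"
  using C_k_on_has_derivative[OF ext(1)] by (simp add: J_def)

lemma linear_J: "q \<in> W \<Longrightarrow> linear (J q)"
  using J_has_derivative has_derivative_linear by blast

lemma linear_K: "q \<in> W \<Longrightarrow> linear (K q)"
  using linear_J[of q] by (auto simp: K_def linear_add linear_cmul inner_simps algebra_simps intro!: linearI)

lemma openin_W: "openin (top_of_set round_sphere) (W \<inter> round_sphere)"
  using openin_open_Int[OF W(1), of round_sphere] by (simp only: Int_commute)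

lemma \<xi>_has_derivative:
  assumes "q \<in> W \<inter> round_sphere"
  shows "(\<xi> has_derivative J q) (at q within round_sphere)"
  by (rule has_derivative_transform_openin[OF
        has_derivative_at_withinI[OF J_has_derivative] openin_W assms ext(2)])
    (use assms in auto)

lemma J_apply_has_derivative:
  assumes "q \<in> W" "(\<eta> has_derivative \<eta>') (at q within T)"
  shows "((\<lambda>p. J p (\<eta> p)) has_derivative (\<lambda>h. J2 q h (\<eta> q) + J q (\<eta>' h))) (at q within T)"
proof -
  have J: "((\<lambda>p. J p i) has_derivative frechet_derivative (\<lambda>p. J p i) (at q)) (at q within T)" for i
  proof -
    have "C_k_on 1 (\<lambda>p. J p i) W" using ext(1)[of 2] by (simp add: J_def numeral_2_eq_2)
    then show ?thesis
      using C_k_on_has_derivative[of 0 "\<lambda>p. J p i" W q] assms(1)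
      by (auto intro: has_derivative_at_withinI)
  qed
  have "((\<lambda>p. \<Sum>i\<in>Basis. (\<eta> p \<bullet> i) *\<^sub>R J p i) has_derivative
      (\<lambda>h. \<Sum>i\<in>Basis. (\<eta> q \<bullet> i) *\<^sub>R frechet_derivative (\<lambda>p. J p i) (at q) h + (\<eta>' h \<bullet> i) *\<^sub>R J q i))
      (at q within T)"
    by (intro has_derivative_sum has_derivative_scaleR J has_derivative_inner_left assms(2))
  moreover have "(\<Sum>i\<in>Basis. (v \<bullet> i) *\<^sub>R J p i) = J p v" if "p \<in> W" for p v
    using linear_Basis_expansion[OF linear_J[OF that], of v] by simp
  ultimately have *: "((\<lambda>p. \<Sum>i\<in>Basis. (\<eta> p \<bullet> i) *\<^sub>R J p i) has_derivative
      (\<lambda>h. J2 q h (\<eta> q) + J q (\<eta>' h))) (at q within T)"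
    using assms(1) by (simp add: sum.distrib J2_def)
  show ?thesis
  proof (rule has_derivative_transform_within_open[OF * W(1) assms(1)])
    show "(\<Sum>i\<in>Basis. (\<eta> p \<bullet> i) *\<^sub>R J p i) = J p (\<eta> p)" if "p \<in> W" for p
      using linear_Basis_expansion[OF linear_J[OF that], of "\<eta> p"] by simp
  qed
qed

section \<open>First-order geometry of the graph at a fixed point\<close>

context
  fixes q
  assumes q: "q \<in> W \<inter> round_sphere"
begin

lemma q_in: "q \<in> W" "q \<in> U" "q \<in> round_sphere" "q \<bullet> q = 1"
  using q W(2) by (auto simp: norm_eq_1)

lemma \<xi>_props: "\<xi> q \<bullet> q = 0" "\<xi> q \<bullet> \<xi> q = 1" "q \<bullet> \<xi> q = 0"
  using vector_field_round_sphere_orth[OF field q_in(2)] unit[OF q_in(2)]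
  by (auto simp: norm_eq_1 inner_commute)

lemma graph_subset_T1: "graph \<subseteq> T1"
proof clarify
  fix p assume "p \<in> U"
  then show "(p, \<xi> p) \<in> T1"
    using vector_field_round_sphere_orth[OF field] unit[of p] by (auto simp: T1_iff norm_eq_1)
qed

lemma \<sigma>_in_T1: "(q, \<xi> q) \<in> T1" using graph_subset_T1 q_in(2) by blast

lemma tangent_q: "tangent_space round_sphere q = {v. v \<bullet> q = 0}"
  by (rule tangent_space_round_sphere[OF q_in(3)])

text \<open>Derivatives of \<open>\<xi> p \<bullet> p = 0\<close> and
  \<open>\<xi> p \<bullet> \<xi> p = 1\<close> in the direction \<open>v\<close>; the extra summand
  of \<open>K\<close> cancels the component along \<open>q\<close>.\<close>

lemma J_orth:
  assumes "v \<bullet> q = 0"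
  shows "J q v \<bullet> q = - (\<xi> q \<bullet> v)" "J q v \<bullet> \<xi> q = 0" "K q v \<bullet> q = 0" "K q v \<bullet> \<xi> q = 0"
proof -
  have v: "v \<in> tangent_space round_sphere q" using assms tangent_q by simp
  note op = vector_field_onD(1)[OF field]
  have "((\<lambda>p. \<xi> p \<bullet> p) has_derivative (\<lambda>h. \<xi> q \<bullet> h + J q h \<bullet> q)) (at q within round_sphere)"
    "((\<lambda>p. \<xi> p \<bullet> \<xi> p) has_derivative (\<lambda>h. \<xi> q \<bullet> J q h + J q h \<bullet> \<xi> q)) (at q within round_sphere)"
    by (auto intro!: derivative_eq_intros \<xi>_has_derivative[OF q])
  note this[THEN has_derivative_const_on_tangent_space[OF _ op q_in(2) _ v]]
  from this(1)[of 0] this(2)[of 1]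
  have "\<xi> q \<bullet> v + J q v \<bullet> q = 0" "\<xi> q \<bullet> J q v + J q v \<bullet> \<xi> q = 0"
    using vector_field_round_sphere_orth[OF field] unit by (auto simp: norm_eq_1)
  then show "J q v \<bullet> q = - (\<xi> q \<bullet> v)" "J q v \<bullet> \<xi> q = 0" "K q v \<bullet> q = 0" "K q v \<bullet> \<xi> q = 0"
    using \<xi>_props q_in(4) by (auto simp: K_def inner_simps inner_commute)
qed

lemma nabla_\<xi>:
  assumes "vector_field_on round_sphere U X"
  shows "nabla X \<xi> q = K q (X q)"
  using levi_civita_round_sphere[OF LC assms field q_in(2) \<xi>_has_derivative[OF q]]
  by (simp add: K_def inner_commute)

text \<open>One inclusion differentiates \<open>snd Q - \<xi> (fst Q) = 0\<close>, valid along the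
  graph. For the other, a normalised line in the sphere is lifted by the smooth
  \<open>\<Xi>\<close>; while the line stays in \<open>W\<close>, the lift lies in the
  graph.\<close>

lemma tangent_space_graph:
  "tangent_space graph (q, \<xi> q) = {(v, J q v) | v. v \<bullet> q = 0}"
proof (intro equalityI subsetI)
  fix z assume z: "z \<in> tangent_space graph (q, \<xi> q)"
  obtain x y where ze: "z = (x, y)" by force
  have "z \<in> tangent_space T1 (q, \<xi> q)" using tangent_space_mono[OF graph_subset_T1] z by blast
  then have "x \<bullet> q = 0" using tangent_space_T1[OF \<sigma>_in_T1] ze by simp
  have op: "openin (top_of_set round_sphere) U" using vector_field_onD(1)[OF field] .
  have "(\<xi> has_derivative J q) (at q within U)"
    using \<xi>_has_derivative[OF q] at_within_openin[OF op q_in(2)] by simp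
  then have "(\<xi> has_derivative J q) (at (fst (q, \<xi> q)) within fst ` graph)"
    by (simp add: image_image)
  from has_derivative_in_compose[OF has_derivative_fst[OF has_derivative_ident] this]
  have "((\<lambda>Q. snd Q - \<xi> (fst Q)) has_derivative (\<lambda>h. snd h - J q (fst h))) (at (q, \<xi> q) within graph)"
    by (auto intro!: derivative_eq_intros)
  from has_derivative_const_on_tangent_space[OF this openin_subtopology_self _ _ z, of 0]
  have "snd z - J q (fst z) = 0" using q_in(2) by (auto simp del: right_minus_eq) auto
  then have "y = J q x" by (simp add: ze)
  then show "z \<in> {(v, J q v) | v. v \<bullet> q = 0}" using ze \<open>x \<bullet> q = 0\<close> by simp
next
  fix z assume "z \<in> {(v, J q v) | v. v \<bullet> q = 0}"
  then obtain v where v: "v \<bullet> q = 0" "z = (v, J q v)" by blast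
  define c where "c t = (1 + t\<^sup>2 * (v \<bullet> v)) powr (-1/2) *\<^sub>R (q + t *\<^sub>R v)" for t :: real
  note c = normalized_line[OF q_in(4) v(1), folded c_def]
  have "continuous_on UNIV c" using c(1)[of 0] by simp
  then have "open (c -` W)" using W(1) by (simp add: open_vimage)
  moreover have "0 \<in> c -` W" using c(3) q_in(1) by simp
  ultimately obtain e where e: "e > 0" "ball 0 e \<subseteq> c -` W"
    using open_contains_ball by blast
  then have cW: "c t \<in> W" if "t \<in> {-e<..<e}" for t
    using that by (auto simp: subset_iff dist_real_def)
  have cS: "c t \<in> round_sphere" for t using c(2)[of t] by (simp only: round_sphere_iff)
  have cc: "C_k_on k c {-e<..<e}" for k using c(1) by (rule C_k_on_subset) simp
  have "c ` {-e<..<e} \<subseteq> W" using cW by blast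
  from C_k_on_compose[OF _ W(1) this ext(1) cc]
  have "C_k_on k (\<lambda>t. (c t, \<Xi> (c t))) {-e<..<e}" for k
    by (intro C_k_on_Pair cc) auto
  then have "smooth_on {-e<..<e} (\<lambda>t. (c t, \<Xi> (c t)))"
    by (intro smooth_on_openI[of "{-e<..<e}"]) auto
  moreover have "(\<lambda>t. (c t, \<Xi> (c t))) ` {-e<..<e} \<subseteq> graph"
  proof clarify
    fix t assume "t \<in> {-e<..<e}"
    then have "c t \<in> W \<inter> round_sphere" using cW cS by blast
    then show "(c t, \<Xi> (c t)) \<in> graph" using ext(2) W(2) by auto
  qed
  moreover have "((\<lambda>t. (c t, \<Xi> (c t))) has_vector_derivative z) (at 0)"
  proof -
    have c': "(c has_derivative (\<lambda>t. t *\<^sub>R v)) (at 0)"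
      using c(4) by (simp add: has_vector_derivative_def)
    have "(\<Xi> has_derivative J q) (at (c 0))" using J_has_derivative[OF q_in(1)] c(3) by simp
    from has_derivative_compose[OF c' this]
    have "((\<lambda>t. \<Xi> (c t)) has_vector_derivative J q v) (at 0)"
      by (simp add: has_vector_derivative_def linear_cmul[OF linear_J[OF q_in(1)]])
    from has_vector_derivative_Pair[OF c(4) this] show ?thesis by (simp add: v(2))
  qed
  ultimately show "z \<in> tangent_space graph (q, \<xi> q)"
    unfolding tangent_space_def using e(1) c(3) ext(2)[OF q]
    by (intro CollectI exI[of _ "\<lambda>t. (c t, \<Xi> (c t))"] exI[of _ e]) auto
qed

lemma subspace_tangent_space_graph: "subspace (tangent_space graph (q, \<xi> q))"
proof -
  have "subspace {v. v \<bullet> q = 0}" by (auto simp: subspace_def inner_simps)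
  moreover have "linear (\<lambda>v. (v, J q v))"
    using linear_J[OF q_in(1)] by (auto simp: linear_add linear_cmul intro!: linearI)
  moreover have "tangent_space graph (q, \<xi> q) = (\<lambda>v. (v, J q v)) ` {v. v \<bullet> q = 0}"
    unfolding tangent_space_graph by blast
  ultimately show ?thesis by (simp add: linear_subspace_image)
qed

end

end

lemma vector_field_on_uminus:
  assumes "vector_field_on round_sphere S X"
  shows "vector_field_on round_sphere S (\<lambda>p. - X p)"
  unfolding vector_field_on_def
proof (intro conjI ballI)
  note X = vector_field_onD[OF assms]
  show "openin (top_of_set round_sphere) S" by (rule X(1))
  show "smooth_on S (\<lambda>p. - X p)"
    unfolding smooth_on_def
  proof
    fix p assume "p \<in> S"
    then obtain W F where W: "open W" "p \<in> W" "\<forall>k. C_k_on k F W" "\<forall>y\<in>W \<inter> S. F y = X y"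
      using X(2) unfolding smooth_on_def by meson
    then show "\<exists>W F. open W \<and> p \<in> W \<and> (\<forall>k. C_k_on k F W) \<and> (\<forall>y\<in>W \<inter> S. F y = - X y)"
      by (intro exI[of _ W] exI[of _ "\<lambda>y. - F y"]) (simp add: C_k_on_uminus)
  qed
  show "- X p \<in> tangent_space round_sphere p" if "p \<in> S" for p
  proof -
    have "p \<in> round_sphere" using that X(1) by (auto simp: openin_open)
    from tangent_space_round_sphere[OF this] show ?thesis using X(3)[OF that] by simp
  qed
qed

section \<open>Reduction of both conditions to one pointwise equation\<close>

context unit_field_germ
begin

text \<open>Near \<open>q\<close> the field \<open>nabla Y \<xi>\<close> is
  \<open>J p (Y p) + (\<xi> p \<bullet> Y p) *\<^sub>R p\<close>, to which the product rule applies.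
  The derivative of \<open>Y\<close> appears inside \<open>J q\<close> and cancels against the term
  with \<open>nabla X Y\<close>, up to the \<open>J q q\<close> in \<open>B\<close> and multiples of
  \<open>q\<close>.\<close>

lemma nabla_nabla_\<xi>:
  assumes q: "q \<in> W \<inter> round_sphere"
    and X: "vector_field_on round_sphere U X" and Y: "vector_field_on round_sphere U Y"
  defines "R \<equiv> nabla X (nabla Y \<xi>) q - nabla (nabla X Y) \<xi> q"
    and "\<beta> \<equiv> B q (X q) (Y q)"
  shows "R = \<beta> - (\<beta> \<bullet> q) *\<^sub>R q + (\<xi> q \<bullet> Y q) *\<^sub>R X q"
    and "K q (X q) \<bullet> K q (Y q) = - (\<beta> \<bullet> \<xi> q) - (\<xi> q \<bullet> Y q) * (\<xi> q \<bullet> X q)"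
proof -
  note qU = q_in[OF q] and \<xi>q = \<xi>_props[OF q]
  note op = vector_field_onD(1)[OF X]
  define x where "x = X q"
  define y where "y = Y q"
  define u where "u = \<xi> q"
  define F where "F = nabla Y \<xi>"
  define w where "w = nabla X Y q"
  have F: "vector_field_on round_sphere U F"
    unfolding F_def by (rule levi_civita_connectionD(1)[OF LC Y field X])
  have XY: "vector_field_on round_sphere U (nabla X Y)"
    by (rule levi_civita_connectionD(1)[OF LC X Y X])
  have Fp: "F p = K p (Y p)" if "p \<in> W \<inter> round_sphere" for p
    unfolding F_def by (rule nabla_\<xi>[OF that Y])
  have xq: "x \<bullet> q = 0" "y \<bullet> q = 0" "w \<bullet> q = 0" "F q \<bullet> q = 0"
    using vector_field_round_sphere_orth(1)[OF _ qU(2)] X Y XY F by (auto simp: x_def y_def w_def)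
  have xT: "X q \<in> tangent_space round_sphere q" by (rule vector_field_onD(3)[OF X qU(2)])
  obtain Y' where Y': "(Y has_derivative Y') (at q within round_sphere)"
    using smooth_on_has_derivative[OF vector_field_onD(2,1)[OF Y] qU(2)] by metis
  define F' where "F' h = (J2 q h y + J q (Y' h)) + ((u \<bullet> y) *\<^sub>R h + (u \<bullet> Y' h + J q h \<bullet> y) *\<^sub>R q)" for h
  have F': "(F has_derivative F') (at q within round_sphere)"
  proof (rule has_derivative_transform_openin[OF _ openin_W q])
    have "((\<lambda>p. J p (Y p) + (\<xi> p \<bullet> Y p) *\<^sub>R p) has_derivative
        (\<lambda>h. (J2 q h (Y q) + J q (Y' h)) + ((\<xi> q \<bullet> Y q) *\<^sub>R h + (\<xi> q \<bullet> Y' h + J q h \<bullet> Y q) *\<^sub>R q)))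
        (at q within round_sphere)"
      by (intro has_derivative_add has_derivative_scaleR has_derivative_inner has_derivative_ident
          J_apply_has_derivative[OF qU(1) Y'] \<xi>_has_derivative[OF q] Y')
    then show "((\<lambda>p. J p (Y p) + (\<xi> p \<bullet> Y p) *\<^sub>R p) has_derivative F') (at q within round_sphere)"
      by (simp add: F'_def[abs_def] u_def y_def)
    show "J p (Y p) + (\<xi> p \<bullet> Y p) *\<^sub>R p = F p" if "p \<in> W \<inter> round_sphere" for p
      using Fp[OF that] by (simp add: K_def)
  qed
  have nF: "nabla X F q = F' x + (x \<bullet> F q) *\<^sub>R q"
    using levi_civita_round_sphere[OF LC X F qU(2) F'] by (simp add: x_def)
  have w: "w = Y' x + (x \<bullet> y) *\<^sub>R q"
    using levi_civita_round_sphere[OF LC X Y qU(2) Y'] by (simp add: x_def y_def w_def)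
  have R: "R = nabla X F q - K q w"
    unfolding R_def F_def w_def using nabla_\<xi>[OF q XY] by simp
  have J_lin: "J q (Y' x) = J q w - (x \<bullet> y) *\<^sub>R J q q"
    using linear_J[OF qU(1)] by (simp add: w linear_add linear_cmul)
  \<comment> \<open>All multiples of \<open>q\<close> go into \<open>l\<close>, whose value is then
    recovered from \<open>R \<bullet> q = 0\<close> instead of being computed.\<close>
  define l where "l = u \<bullet> Y' x + J q x \<bullet> y + x \<bullet> F q - u \<bullet> w"
  have Rl: "R = \<beta> + (u \<bullet> y) *\<^sub>R x + l *\<^sub>R q"
    unfolding R nF F'_def J_lin l_def \<beta>_def B_def K_def x_def[symmetric] y_def[symmetric] u_def[symmetric]
    by (simp add: algebra_simps)
  have nFq: "nabla X F q \<bullet> q = 0"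
    by (rule vector_field_round_sphere_orth(1)[OF levi_civita_connectionD(1)[OF LC X F X] qU(2)])
  then have "R \<bullet> q = 0"
    using J_orth(3)[OF q xq(3)] by (simp add: R inner_diff_left)
  then have l: "l = - (\<beta> \<bullet> q)"
    using xq qU(4) by (simp add: Rl inner_simps)
  then show "R = \<beta> - (\<beta> \<bullet> q) *\<^sub>R q + (\<xi> q \<bullet> Y q) *\<^sub>R X q"
    using Rl by (simp add: u_def x_def y_def)
  have "((\<lambda>p. F p \<bullet> \<xi> p) has_derivative (\<lambda>h. F q \<bullet> J q h + F' h \<bullet> \<xi> q)) (at q within round_sphere)"
    by (intro has_derivative_inner F' \<xi>_has_derivative[OF q])
  from has_derivative_const_on_tangent_space[OF this openin_W q _ xT, of 0]
  moreover have "F p \<bullet> \<xi> p = 0" if "p \<in> W \<inter> round_sphere" for p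
    using J_orth(4)[OF that vector_field_round_sphere_orth(1)[OF Y q_in(2)[OF that]]] Fp[OF that] by simp
  ultimately have "F q \<bullet> J q x + F' x \<bullet> u = 0" by (simp add: x_def u_def)
  moreover have "F q \<bullet> J q x = K q x \<bullet> K q y"
    using Fp[OF q] xq(4) by (simp add: y_def K_def[of q x] inner_simps inner_commute)
  moreover have "R \<bullet> u = F' x \<bullet> u"
    using J_orth(4)[OF q xq(3)] \<xi>q by (simp add: R nF inner_simps u_def)
  moreover have "R \<bullet> u = \<beta> \<bullet> u + (u \<bullet> y) * (u \<bullet> x)"
    using \<xi>q by (simp add: Rl inner_simps u_def inner_commute)
  ultimately show "K q (X q) \<bullet> K q (Y q) = - (\<beta> \<bullet> \<xi> q) - (\<xi> q \<bullet> Y q) * (\<xi> q \<bullet> X q)"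
    by (simp add: u_def x_def y_def)
qed

text \<open>The shape operator at \<open>q\<close> is \<open>- K q\<close>. With
  \<open>K q (X q) \<bullet> K q (Y q)\<close> rewritten by \<open>nabla_nabla_\<xi>\<close>, right
  minus left side is identically the difference of the two sides of
  \<open>geodesic_eq\<close>.\<close>

lemma shape_operator_equation_iff:
  assumes q: "q \<in> W \<inter> round_sphere"
    and X: "vector_field_on round_sphere U X" and Y: "vector_field_on round_sphere U Y"
  defines "A \<equiv> shape_operator nabla \<xi>"
  shows "shape_operator_deriv nabla \<xi> X Y q =
         (1/2) *\<^sub>R (lie_deriv_metric nabla round_metric \<xi> X Y q *\<^sub>R A \<xi> q
                 + (\<xi> q \<bullet> X q) *\<^sub>R (A (A Y) q + Y q)
                 + (\<xi> q \<bullet> Y q) *\<^sub>R (A (A X) q - X q))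
         + (A X q \<bullet> A Y q) *\<^sub>R \<xi> q
    \<longleftrightarrow> geodesic_eq q (X q) (Y q)" (is "?l = ?r \<longleftrightarrow> _")
proof -
  define \<beta> where "\<beta> = B q (X q) (Y q)"
  note R = nabla_nabla_\<xi>[OF q X Y, folded \<beta>_def]
  have A: "A Z q = - K q (Z q)" if "vector_field_on round_sphere U Z" for Z
    unfolding A_def shape_operator_def using nabla_\<xi>[OF q that] by simp
  have AA: "A (A Z) q = K q (K q (Z q))" if Z: "vector_field_on round_sphere U Z" for Z
  proof -
    have "vector_field_on round_sphere U (A Z)"
      unfolding A_def shape_operator_def
      by (rule vector_field_on_uminus, rule levi_civita_connectionD(1)[OF LC Z field X])
    from A[OF this] A[OF Z] show ?thesis
      by (simp add: linear_neg[OF linear_K[OF q_in(1)[OF q]]])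
  qed
  define m where "m = K q (X q) \<bullet> Y q + K q (Y q) \<bullet> X q"
  have lie: "lie_deriv_metric nabla round_metric \<xi> X Y q = m"
    using nabla_\<xi>[OF q X] nabla_\<xi>[OF q Y] by (simp add: lie_deriv_metric_def m_def inner_commute)
  have l: "?l = - (\<beta> - (\<beta> \<bullet> q) *\<^sub>R q + (\<xi> q \<bullet> Y q) *\<^sub>R X q)"
    by (simp only: shape_operator_deriv_def R(1))
  have r: "?r = (1/2) *\<^sub>R (m *\<^sub>R (- K q (\<xi> q))
                 + (\<xi> q \<bullet> X q) *\<^sub>R (K q (K q (Y q)) + Y q)
                 + (\<xi> q \<bullet> Y q) *\<^sub>R (K q (K q (X q)) - X q))
         + (- (\<beta> \<bullet> \<xi> q) - (\<xi> q \<bullet> Y q) * (\<xi> q \<bullet> X q)) *\<^sub>R \<xi> q"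
    unfolding lie AA[OF X] AA[OF Y] A[OF field] A[OF X] A[OF Y] inner_minus_left inner_minus_right
      minus_minus R(2) ..
  define g where "g = \<beta> - (\<beta> \<bullet> q) *\<^sub>R q - (\<beta> \<bullet> \<xi> q) *\<^sub>R \<xi> q
       + (1/2) *\<^sub>R ((\<xi> q \<bullet> Y q) *\<^sub>R X q + (\<xi> q \<bullet> X q) *\<^sub>R Y q) - ((\<xi> q \<bullet> X q) * (\<xi> q \<bullet> Y q)) *\<^sub>R \<xi> q"
  define g' where "g' = K q (((1/2) * m) *\<^sub>R \<xi> q - ((1/2) * (\<xi> q \<bullet> Y q)) *\<^sub>R K q (X q)
       - ((1/2) * (\<xi> q \<bullet> X q)) *\<^sub>R K q (Y q))"
  have g': "g' = ((1/2) * m) *\<^sub>R K q (\<xi> q) - ((1/2) * (\<xi> q \<bullet> Y q)) *\<^sub>R K q (K q (X q))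
       - ((1/2) * (\<xi> q \<bullet> X q)) *\<^sub>R K q (K q (Y q))"
    using linear_K[OF q_in(1)[OF q]] unfolding g'_def by (simp only: linear_diff linear_cmul)
  \<comment> \<open>Pairing with an arbitrary vector turns the vector identity into one between real
    polynomials.\<close>
  have "?r - ?l = g - g'"
    unfolding l r g_def g'
    by (rule vector_eq_rdot[THEN iffD1]) (simp add: inner_simps algebra_simps)
  then have "?l = ?r \<longleftrightarrow> g = g'" by (metis right_minus_eq)
  then show ?thesis
    by (simp only: geodesic_eq_def g_def g'_def m_def \<beta>_def)
qed

text \<open>Along the graph the second component of \<open>Y\<close> is \<open>J p\<close> of the
  first. Differentiating this relation expresses \<open>d2\<close> through \<open>d1\<close> and the
  second derivative of \<open>\<Xi>\<close>, so that \<open>levi_civita_T1\<close> can be compared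
  with the tangent space of the graph.\<close>

lemma second_fundamental_form_graph_iff:
  assumes LCT: "levi_civita_connection T1 (sasaki_metric round_sphere round_metric nabla) nablaT"
    and q: "q \<in> W \<inter> round_sphere" and qS: "(q, \<xi> q) \<in> S"
    and X: "vector_field_on T1 S X" and Y: "vector_field_on T1 S Y"
    and tan: "\<And>p. p \<in> S \<inter> graph \<Longrightarrow> X p \<in> tangent_space graph p \<and> Y p \<in> tangent_space graph p"
  shows "second_fundamental_form T1 (sasaki_metric round_sphere round_metric nabla) nablaT graph X Y (q, \<xi> q) = 0
    \<longleftrightarrow> geodesic_eq q (fst (X (q, \<xi> q))) (fst (Y (q, \<xi> q)))"
proof -
  note qU = q_in[OF q] and \<xi>q = \<xi>_props[OF q]
  note lin = linear_J[OF qU(1)]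
  define x where "x = fst (X (q, \<xi> q))"
  define y where "y = fst (Y (q, \<xi> q))"
  define u where "u = \<xi> q"
  have tanY: "snd (Y (p, \<xi> p)) = J p (fst (Y (p, \<xi> p)))" "fst (Y (p, \<xi> p)) \<bullet> p = 0"
    and tanX: "snd (X (p, \<xi> p)) = J p (fst (X (p, \<xi> p)))" "fst (X (p, \<xi> p)) \<bullet> p = 0"
    if "p \<in> W \<inter> round_sphere" "(p, \<xi> p) \<in> S" for p
  proof -
    have "(p, \<xi> p) \<in> S \<inter> graph" using that q_in(2)[OF that(1)] by blast
    from tan[OF this] show "snd (Y (p, \<xi> p)) = J p (fst (Y (p, \<xi> p)))" "fst (Y (p, \<xi> p)) \<bullet> p = 0"
      "snd (X (p, \<xi> p)) = J p (fst (X (p, \<xi> p)))" "fst (X (p, \<xi> p)) \<bullet> p = 0"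
      unfolding tangent_space_graph[OF that(1)] by auto
  qed
  have Xp: "X (q, u) = (x, J q x)" and Yp: "Y (q, u) = (y, J q y)"
    using tanX[OF q qS] tanY[OF q qS] by (simp_all add: x_def y_def u_def prod_eq_iff)
  have xq: "x \<bullet> q = 0" "y \<bullet> q = 0"
    using tanX[OF q qS] tanY[OF q qS] by (simp_all add: x_def y_def)
  have xT: "x \<in> tangent_space round_sphere q" using xq tangent_q[OF q] by simp
  obtain Y' where Y': "(Y has_derivative Y') (at (q, u) within T1)"
    using smooth_on_has_derivative[OF vector_field_onD(2,1)[OF Y] qS] unfolding u_def by metis
  define \<eta>' where "\<eta>' h = Y' (h, J q h)" for h
  have \<eta>': "((\<lambda>p. Y (p, \<xi> p)) has_derivative \<eta>') (at q within round_sphere)"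
  proof -
    have op: "openin (top_of_set round_sphere) U" by (rule vector_field_onD(1)[OF field])
    have "((\<lambda>p. (p, \<xi> p)) has_derivative (\<lambda>h. (h, J q h))) (at q within U)"
      using \<xi>_has_derivative[OF q] unfolding at_within_openin[OF op qU(2)]
      by (intro has_derivative_Pair has_derivative_ident)
    moreover have "(Y has_derivative Y') (at (q, \<xi> q) within graph)"
      using Y' unfolding u_def by (rule has_derivative_subset) (rule graph_subset_T1[OF q])
    ultimately have "((\<lambda>p. Y (p, \<xi> p)) has_derivative (\<lambda>h. Y' (h, J q h))) (at q within U)"
      by (rule has_derivative_in_compose)
    then show ?thesis unfolding \<eta>'_def at_within_openin[OF op qU(2)] .
  qed
  obtain d1 d2 where d: "Y' (x, J q x) = (d1, d2)" by force
  \<comment> \<open>Tangency to the graph is given only at points of \<open>S\<close>; over this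
    relatively open part of the sphere it holds and may be differentiated.\<close>
  define V where "V = (W \<inter> round_sphere) \<inter> (\<lambda>p. (p, \<xi> p)) -` S"
  have V: "openin (top_of_set round_sphere) V"
  proof -
    obtain O' where O': "open O'" "S = T1 \<inter> O'"
      using vector_field_onD(1)[OF X] by (auto simp: openin_open)
    have cont: "continuous_on (W \<inter> round_sphere) (\<lambda>p. (p, \<xi> p))"
    proof -
      have "continuous_on (W \<inter> round_sphere) \<Xi>"
        using ext(1)[of 0] by (auto intro: continuous_on_subset)
      moreover have "continuous_on (W \<inter> round_sphere) \<Xi> \<longleftrightarrow> continuous_on (W \<inter> round_sphere) \<xi>"
        by (rule continuous_on_cong[OF refl ext(2)])
      ultimately have "continuous_on (W \<inter> round_sphere) \<xi>" by simp
      then show ?thesis by (intro continuous_intros)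
    qed
    have "V = (W \<inter> round_sphere) \<inter> (\<lambda>p. (p, \<xi> p)) -` O'"
      using O'(2) graph_subset_T1[OF q] W(2) by (auto simp: V_def)
    then have "openin (top_of_set (W \<inter> round_sphere)) V"
      using continuous_openin_preimage_gen[OF cont O'(1)] by simp
    then show ?thesis using openin_W openin_trans by blast
  qed
  have qV: "q \<in> V" using q qS by (simp add: V_def)
  have d2: "d2 = J2 q x y + J q d1"
  proof -
    have fst': "((\<lambda>p. fst (Y (p, \<xi> p))) has_derivative (\<lambda>h. fst (\<eta>' h))) (at q within round_sphere)"
      by (rule has_derivative_fst[OF \<eta>'])
    have 1: "((\<lambda>p. J p (fst (Y (p, \<xi> p)))) has_derivative
        (\<lambda>h. J2 q h (fst (Y (q, \<xi> q))) + J q (fst (\<eta>' h)))) (at q within round_sphere)"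
      by (rule J_apply_has_derivative[OF qU(1) fst'])
    have "((\<lambda>p. snd (Y (p, \<xi> p))) has_derivative
        (\<lambda>h. J2 q h (fst (Y (q, \<xi> q))) + J q (fst (\<eta>' h)))) (at q within round_sphere)"
      by (rule has_derivative_transform_openin[OF 1 V qV]) (use tanY in \<open>auto simp: V_def\<close>)
    from has_derivative_unique_on_tangent_space[OF has_derivative_snd[OF \<eta>'] this xT]
    show ?thesis by (simp add: \<eta>'_def d y_def)
  qed
  have d1q: "d1 \<bullet> q = - (x \<bullet> y)"
  proof -
    have "((\<lambda>p. fst (Y (p, \<xi> p)) \<bullet> p) has_derivative
        (\<lambda>h. fst (Y (q, \<xi> q)) \<bullet> h + fst (\<eta>' h) \<bullet> q)) (at q within round_sphere)"
      by (intro has_derivative_inner has_derivative_fst[OF \<eta>'] has_derivative_ident)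
    from has_derivative_const_on_tangent_space[OF this V qV _ xT, of 0] show ?thesis
      using tanY by (auto simp: V_def \<eta>'_def d y_def inner_commute)
  qed
  \<comment> \<open>The derivative of \<open>Y\<close> occurs in the horizontal part only through
    the tangent vector \<open>w\<close>; \<open>r\<close> collects the curvature terms.\<close>
  define w where "w = d1 + (x \<bullet> y) *\<^sub>R q"
  have wq: "w \<bullet> q = 0" using d1q qU(4) by (simp add: w_def inner_simps)
  define r where "r = ((1/2) * (K q x \<bullet> y + K q y \<bullet> x)) *\<^sub>R u
      - ((1/2) * (u \<bullet> y)) *\<^sub>R K q x - ((1/2) * (u \<bullet> x)) *\<^sub>R K q y"
  define \<beta> where "\<beta> = B q x y"
  define g where "g = \<beta> - (\<beta> \<bullet> q) *\<^sub>R q - (\<beta> \<bullet> u) *\<^sub>R u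
    + (1/2) *\<^sub>R ((u \<bullet> y) *\<^sub>R x + (u \<bullet> x) *\<^sub>R y) - ((u \<bullet> x) * (u \<bullet> y)) *\<^sub>R u"
  define s where "s = w + r"
  have d2w: "d2 = \<beta> + J q w"
    by (simp add: d2 \<beta>_def B_def w_def linear_add[OF lin] linear_cmul[OF lin])
  have Kxy: "J q x \<bullet> y = K q x \<bullet> y" "J q y \<bullet> x = K q y \<bullet> x"
    using xq by (simp_all add: K_def inner_simps inner_commute)
  have D: "nablaT X Y (q, u) = (s, d2 - (d2 \<bullet> q) *\<^sub>R q - (d2 \<bullet> u) *\<^sub>R u
      + (1/2) *\<^sub>R ((u \<bullet> y) *\<^sub>R x + (u \<bullet> x) *\<^sub>R y) - ((u \<bullet> x) * (u \<bullet> y)) *\<^sub>R u - (u \<bullet> s) *\<^sub>R q)"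
    using levi_civita_T1[OF LC LCT X Y qS[folded u_def] Y' Xp Yp d]
    unfolding Kxy s_def r_def w_def K_def u_def by (simp add: add_diff_eq)
  have "d2 - (d2 \<bullet> q) *\<^sub>R q - (d2 \<bullet> u) *\<^sub>R u = \<beta> - (\<beta> \<bullet> q) *\<^sub>R q - (\<beta> \<bullet> u) *\<^sub>R u + K q w"
    using J_orth(1,2)[OF q wq] by (simp add: d2w inner_add_left K_def u_def algebra_simps)
  then have D': "nablaT X Y (q, u) = (s, g + K q w - (u \<bullet> s) *\<^sub>R q)"
    unfolding D g_def by (simp add: algebra_simps)
  have sq: "s \<bullet> q = 0"
    using wq J_orth(3)[OF q xq(1)] J_orth(3)[OF q xq(2)] \<xi>q
    by (simp add: s_def r_def inner_simps u_def)
  have "nablaT X Y (q, \<xi> q) \<in> tangent_space graph (q, \<xi> q) \<longleftrightarrow> g + K q w - (u \<bullet> s) *\<^sub>R q = J q s"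
    using D' sq unfolding tangent_space_graph[OF q] u_def by auto
  \<comment> \<open>The multiple of \<open>q\<close> is exactly the difference between
    \<open>K q s\<close> and \<open>J q s\<close>. Linearity of \<open>K q\<close> with
    \<open>s = w + r\<close> then removes \<open>w\<close>.\<close>
  also have "\<dots> \<longleftrightarrow> g + K q w = K q s" by (simp add: K_def u_def algebra_simps)
  also have "\<dots> \<longleftrightarrow> g = K q r"
    by (simp add: s_def linear_add[OF linear_K[OF qU(1)]] add.commute)
  also have "\<dots> \<longleftrightarrow> geodesic_eq q x y"
    by (simp only: geodesic_eq_def g_def r_def \<beta>_def u_def)
  finally have "nablaT X Y (q, \<xi> q) \<in> tangent_space graph (q, \<xi> q) \<longleftrightarrow> geodesic_eq q x y" .
  moreover have "nablaT X Y (q, \<xi> q) \<in> tangent_space T1 (q, \<xi> q)"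
    by (rule vector_field_onD(3)[OF levi_civita_connectionD(1)[OF LCT X Y X] qS])
  ultimately show ?thesis
    using second_fundamental_form_T1_eq_0_iff[OF LC subspace_tangent_space_graph[OF q]
        graph_subset_T1[OF q] \<sigma>_in_T1[OF q]]
    by (simp add: x_def y_def)
qed

text \<open>The field must be tangent to the graph along all of its part over \<open>W\<close> and
  live on an open part of \<open>T1\<close>. The graph tangent \<open>(a p, J p (a p))\<close> is
  therefore made independent of the second coordinate and projected by \<open>proj_T1\<close>, which
  changes nothing on the graph.\<close>

lemma tangent_field_extension:
  assumes q: "q \<in> W \<inter> round_sphere" and x: "x \<bullet> q = 0"
  shows "\<exists>X. vector_field_on T1 (T1 \<inter> W \<times> UNIV) X \<and> fst (X (q, \<xi> q)) = x \<and>
    (\<forall>p\<in>(T1 \<inter> W \<times> UNIV) \<inter> graph. X p \<in> tangent_space graph p)"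
proof -
  define a where "a p = x - (x \<bullet> p) *\<^sub>R p" for p
  define F where "F Q = (a (fst Q), J (fst Q) (a (fst Q)))" for Q :: "'a \<times> 'a"
  define X where "X Q = proj_T1 Q (F Q)" for Q
  have op: "open (W \<times> (UNIV :: 'a set))" using W(1) by (intro open_Times) auto
  have "C_k_on k (\<lambda>p. p) W" for k by (intro C_k_on_linear W(1) bounded_linear_ident)
  then have a: "C_k_on k a W" for k
    unfolding a_def using W(1) by (intro C_k_on_diff C_k_on_scaleR C_k_on_inner C_k_on_const)
  then have "C_k_on k (\<lambda>p. (a p, J p (a p))) W" for k
    unfolding J_def using W(1) ext(1) by (intro C_k_on_Pair C_k_on_frechet_derivative) auto
  moreover have "C_k_on k fst (W \<times> (UNIV :: 'a set))" for k
    by (intro C_k_on_linear op bounded_linear_fst)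
  ultimately have F: "C_k_on k F (W \<times> UNIV)" for k
    unfolding F_def by (rule_tac C_k_on_compose[OF op W(1)]) auto
  have XV: "vector_field_on T1 (T1 \<inter> W \<times> UNIV) X"
    unfolding X_def using op by (intro vector_field_proj_T1[OF op F]) (auto intro: openin_open_Int)
  have Xg: "X (p, \<xi> p) = (a p, J p (a p)) \<and> X (p, \<xi> p) \<in> tangent_space graph (p, \<xi> p)"
    if "p \<in> W \<inter> round_sphere" for p
  proof -
    have "a p \<bullet> p = 0" using q_in(4)[OF that] by (simp add: a_def inner_diff_left)
    then have 1: "(a p, J p (a p)) \<in> tangent_space graph (p, \<xi> p)"
      unfolding tangent_space_graph[OF that] by blast
    then have "(a p, J p (a p)) \<in> tangent_space T1 (p, \<xi> p)"
      using tangent_space_mono[OF graph_subset_T1[OF that]] by blast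
    then show ?thesis
      using 1 proj_T1_id[OF \<sigma>_in_T1[OF that]] by (simp add: X_def F_def)
  qed
  moreover have "p \<in> round_sphere" if "p \<in> U" for p
    using that vector_field_onD(1)[OF field] by (auto simp: openin_open)
  ultimately have "X p \<in> tangent_space graph p" if "p \<in> (T1 \<inter> W \<times> UNIV) \<inter> graph" for p
    using that by auto
  moreover have "fst (X (q, \<xi> q)) = x" using Xg[OF q] x by (simp add: a_def)
  ultimately show ?thesis using XV by blast
qed

end

theorem lemma3p1:
  fixes n :: nat
    and nabla :: "('a::euclidean_space \<Rightarrow> 'a) \<Rightarrow> ('a \<Rightarrow> 'a) \<Rightarrow> 'a \<Rightarrow> 'a"
    and nablaT :: "('a \<times> 'a \<Rightarrow> 'a \<times> 'a) \<Rightarrow> ('a \<times> 'a \<Rightarrow> 'a \<times> 'a) \<Rightarrow> 'a \<times> 'a \<Rightarrow> 'a \<times> 'a"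
    and U :: "'a set"
    and \<xi> :: "'a \<Rightarrow> 'a"
  assumes dim: "DIM('a) = n + 2"
    and nabla: "levi_civita_connection round_sphere round_metric nabla"
    and nablaT: "levi_civita_connection (unit_tangent_bundle round_sphere round_metric)
                   (sasaki_metric round_sphere round_metric nabla) nablaT"
    and field: "vector_field_on round_sphere U \<xi>"
    and unit: "\<And>q. q \<in> U \<Longrightarrow> norm (\<xi> q) = 1"
  shows "totally_geodesic (unit_tangent_bundle round_sphere round_metric)
           (sasaki_metric round_sphere round_metric nabla) nablaT ((\<lambda>q. (q, \<xi> q)) ` U)
    \<longleftrightarrow>
    (\<forall>X Y. vector_field_on round_sphere U X \<longrightarrow> vector_field_on round_sphere U Y \<longrightarrow>
      (let A = shape_operator nabla \<xi> in
       \<forall>q\<in>U. shape_operator_deriv nabla \<xi> X Y q =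
         (1/2) *\<^sub>R (lie_deriv_metric nabla round_metric \<xi> X Y q *\<^sub>R A \<xi> q
                 + (\<xi> q \<bullet> X q) *\<^sub>R (A (A Y) q + Y q)
                 + (\<xi> q \<bullet> Y q) *\<^sub>R (A (A X) q - X q))
         + (A X q \<bullet> A Y q) *\<^sub>R \<xi> q))"
proof -
  note op = vector_field_onD(1)[OF field]
  have US: "q \<in> round_sphere" if "q \<in> U" for q using that op by (auto simp: openin_open)
  \<comment> \<open>A smooth extension of \<open>\<xi>\<close> is provided only near each point, so
    the locale is interpreted afresh at every \<open>q\<close>.\<close>
  have germ: "\<exists>W \<Xi>. unit_field_germ nabla \<xi> \<Xi> U W \<and> q \<in> W \<inter> round_sphere" if q: "q \<in> U" for q
  proof -
    obtain W \<Xi> where "open W" "q \<in> W" "\<forall>k. C_k_on k \<Xi> W" "W \<inter> round_sphere \<subseteq> U"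
      "\<forall>y\<in>W \<inter> round_sphere. \<Xi> y = \<xi> y"
      using smooth_on_local_extension[OF vector_field_onD(2)[OF field] op q] by metis
    then have "unit_field_germ nabla \<xi> \<Xi> U W"
      by (intro unit_field_germ.intro nabla field unit) auto
    then show ?thesis using \<open>q \<in> W\<close> US[OF q] by blast
  qed
  let ?N = "(\<lambda>q. (q, \<xi> q)) ` U"
  show ?thesis
    unfolding Let_def
  proof (intro iffI allI impI ballI)
    fix X Y q
    assume tg: "totally_geodesic T1 (sasaki_metric round_sphere round_metric nabla) nablaT ?N"
      and X: "vector_field_on round_sphere U X" and Y: "vector_field_on round_sphere U Y"
      and q: "q \<in> U"
    obtain W \<Xi> where "unit_field_germ nabla \<xi> \<Xi> U W" and qW: "q \<in> W \<inter> round_sphere"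
      using germ[OF q] by blast
    then interpret unit_field_germ nabla \<xi> \<Xi> U W by simp
    \<comment> \<open>\<open>totally_geodesic\<close> admits fields on any relatively open subset of
      \<open>T1\<close>, so an extension over \<open>W\<close> is enough to test it.\<close>
    obtain X' where X': "vector_field_on T1 (T1 \<inter> W \<times> UNIV) X'" "fst (X' (q, \<xi> q)) = X q"
      "\<forall>p\<in>(T1 \<inter> W \<times> UNIV) \<inter> ?N. X' p \<in> tangent_space ?N p"
      using tangent_field_extension[OF qW vector_field_round_sphere_orth(1)[OF X q]] by blast
    obtain Y' where Y': "vector_field_on T1 (T1 \<inter> W \<times> UNIV) Y'" "fst (Y' (q, \<xi> q)) = Y q"
      "\<forall>p\<in>(T1 \<inter> W \<times> UNIV) \<inter> ?N. Y' p \<in> tangent_space ?N p"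
      using tangent_field_extension[OF qW vector_field_round_sphere_orth(1)[OF Y q]] by blast
    have qS: "(q, \<xi> q) \<in> T1 \<inter> W \<times> UNIV" using \<sigma>_in_T1[OF qW] qW by simp
    have "second_fundamental_form T1 (sasaki_metric round_sphere round_metric nabla) nablaT ?N X' Y' (q, \<xi> q) = 0"
      using tg X' Y' qS q unfolding totally_geodesic_def by blast
    then have "geodesic_eq q (X q) (Y q)"
      using second_fundamental_form_graph_iff[OF nablaT qW qS X'(1) Y'(1)] X' Y' by simp
    then show "shape_operator_deriv nabla \<xi> X Y q =
         (1/2) *\<^sub>R (lie_deriv_metric nabla round_metric \<xi> X Y q *\<^sub>R shape_operator nabla \<xi> \<xi> q
           + (\<xi> q \<bullet> X q) *\<^sub>R (shape_operator nabla \<xi> (shape_operator nabla \<xi> Y) q + Y q)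
           + (\<xi> q \<bullet> Y q) *\<^sub>R (shape_operator nabla \<xi> (shape_operator nabla \<xi> X) q - X q))
         + (shape_operator nabla \<xi> X q \<bullet> shape_operator nabla \<xi> Y q) *\<^sub>R \<xi> q"
      using shape_operator_equation_iff[OF qW X Y] by simp
  next
    assume eq: "\<forall>X Y. vector_field_on round_sphere U X \<longrightarrow> vector_field_on round_sphere U Y \<longrightarrow>
       (\<forall>q\<in>U. shape_operator_deriv nabla \<xi> X Y q =
         (1/2) *\<^sub>R (lie_deriv_metric nabla round_metric \<xi> X Y q *\<^sub>R shape_operator nabla \<xi> \<xi> q
           + (\<xi> q \<bullet> X q) *\<^sub>R (shape_operator nabla \<xi> (shape_operator nabla \<xi> Y) q + Y q)
           + (\<xi> q \<bullet> Y q) *\<^sub>R (shape_operator nabla \<xi> (shape_operator nabla \<xi> X) q - X q))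
         + (shape_operator nabla \<xi> X q \<bullet> shape_operator nabla \<xi> Y q) *\<^sub>R \<xi> q)"
    show "totally_geodesic T1 (sasaki_metric round_sphere round_metric nabla) nablaT ?N"
      unfolding totally_geodesic_def
    proof (intro allI impI ballI)
      fix S X Y p
      assume X: "vector_field_on T1 S X" and Y: "vector_field_on T1 S Y"
        and tan: "\<forall>p\<in>S \<inter> ?N. X p \<in> tangent_space ?N p \<and> Y p \<in> tangent_space ?N p"
        and p: "p \<in> S \<inter> ?N"
      then obtain q where pq: "p = (q, \<xi> q)" and q: "q \<in> U" by blast
      obtain W \<Xi> where "unit_field_germ nabla \<xi> \<Xi> U W" and qW: "q \<in> W \<inter> round_sphere"
        using germ[OF q] by blast
      then interpret unit_field_germ nabla \<xi> \<Xi> U W by simp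
      define x where "x = fst (X p)"
      define y where "y = fst (Y p)"
      have "X p \<in> tangent_space ?N p" "Y p \<in> tangent_space ?N p" using tan p by blast+
      then have orth: "x \<bullet> q = 0" "y \<bullet> q = 0"
        unfolding pq tangent_space_graph[OF qW] by (auto simp: x_def y_def pq)
      have V: "vector_field_on round_sphere U (\<lambda>p. z - (z \<bullet> p) *\<^sub>R p)" for z
        by (rule vector_field_round_sphere_const[OF op])
      have "geodesic_eq q (x - (x \<bullet> q) *\<^sub>R q) (y - (y \<bullet> q) *\<^sub>R q)"
        using shape_operator_equation_iff[OF qW V[of x] V[of y]] eq V q by blast
      then have "geodesic_eq q x y" by (simp add: orth)
      then show "second_fundamental_form T1 (sasaki_metric round_sphere round_metric nabla) nablaT ?N X Y p = 0"
        using second_fundamental_form_graph_iff[OF nablaT qW _ X Y] tan p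
        by (simp add: pq x_def y_def)
    qed
  qed
qed

end
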